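(* Let $T>0$, $u_0\in\mathbb{R}$, and let $\alpha,\beta,f\in C^\infty(\mathbb{R})$ be real analytic functions such that the Itô stochastic differential equation $du=\alpha(u)\,dt+\beta(u)\,dW$, $u(0)=u_0$, admits a unique solution $u$ on $[0,T]$. Then $$\mathbb{E}^{u_0}[f(u_t)]=\sum_{\tau\in\mathcal{T}^{\mathfrak e}_{\alpha,\beta}}\frac{\Upsilon^{\alpha,\beta,f}_{u_0}(\tau)}{\sigma_{\mathfrak e}(\tau)}\,\Pi^{\mathfrak e}_t(\tau)$$ as a formal series.
   Context: Formal series: $W$ is a one-dimensional Wiener process and $L:=\alpha\,\partial_x+\tfrac12\beta^2\,\partial_x^2$. Formally, $\mathbb{E}^{u_0}[f(u_t)]$ is understood as its Itô–Taylor series $\sum_{k\ge0}\frac{t^k}{k!}(L^kf)(u_0)$, obtained by iterating Itô's formula and taking expectations. The claimed equality holds order by order: for every $k\ge0$ and $t\in[0,T]$, $\frac{t^k}{k!}(L^kf)(u_0)$ equals the (finite) sum over trees with $|\tau|=k+1$ on the right-hand side. No convergence is asserted. Exotic coloured trees: an exotic coloured tree $\tau$ is a finite non-planar rooted tree with edges oriented towards the root $\rho_\tau$; the root is uncoloured; every non-root vertex $v$ has a colour $\mathfrak t(v)\in\{\alpha,\beta\}$; the set $\mathcal V_\beta(\tau)$ of $\beta$-coloured vertices has even cardinality and is equipped with an exotic decoration $\mathfrak e$, i.e. a partition of $\mathcal V_\beta(\tau)$ into pairs ($\mathfrak e(v)=\mathfrak e(w)$ iff $v,w$ are in the same pair;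 labels irrelevant). Paired vertices may be anywhere in the tree. $\mathcal V_\alpha(\tau)$ is the set of $\alpha$-coloured vertices. $\mathcal{T}^{\mathfrak e}_{\alpha,\beta}$ is the set of isomorphism classes of such trees (including the single root $\bullet$). Set $|\tau|:=|\mathcal V_\alpha(\tau)|+\tfrac12|\mathcal V_\beta(\tau)|+1$, and let $\mathfrak n(v)$ be the number of incoming edges (children) of $v$. Symmetry factor: $\sigma_{\mathfrak e}(\tau)$ is the number of automorphisms of the rooted tree $\tau$ preserving the colours and the partition of $\mathcal V_\beta(\tau)$ into pairs (pairs may be permuted among themselves). Elementary differential: for $x\in\mathbb{R}$, $\Upsilon^{\alpha,\beta,f}_{x}(\tau):=f^{(\mathfrak n(\rho_\tau))}(x)\prod_{v\ne\rho_\tau}\mathfrak t(v)^{(\mathfrak n(v))}(x)$, where $\mathfrak t(v)\in\{\alpha,\beta\}$ is regarded as the corresponding coefficient function. Exotic realization map: $\Theta$ is the Heaviside function with $\Theta(0)=0$. $\Pi^{\mathfrak e}_t(\bullet)=1$ and, for $|\tau|>1$, $$\Pi^{\mathfrak e}_t(\tau)=\int\ \prod_{e:\,e_+=\rho_\tau}\Theta(t-t_{e_-})\prod_{e:\,e_+\ne\rho_\tau}\Theta(t_{e_+}-t_{e_-})\prod_{\{v,w\}:\,\mathfrak e(v)=\mathfrak e(w)}\delta(t_v-t_w)\prod_{v\neq\rho_\tau}dt_v,$$ where each edge $e=(e_+,e_-)$ points from $e_-$ towards $e_+$ (the endpoint closer to the root) and all variables range over $[0,T]$. The Dirac deltas mean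 that the integration variables of two $\beta$-vertices in the same pair are identified; thus the integral is over $[0,T]^{|\tau|-1}$ with one variable per $\alpha$-vertex and one per pair of $\beta$-vertices. *)

theory Defs
  imports "HOL-Probability.Probability" "HOL-Library.Disjoint_Sets" "HOL-Combinatorics.Permutations"
begin

section \<open>Coefficient functions\<close>

definition smooth_fun :: "(real \<Rightarrow> real) \<Rightarrow> bool" where
  "smooth_fun g \<longleftrightarrow> (\<forall>n x. ((deriv ^^ n) g) field_differentiable (at x))"

definition real_analytic :: "(real \<Rightarrow> real) \<Rightarrow> bool" where
  "real_analytic g \<longleftrightarrow> (\<forall>x. \<exists>F. (\<lambda>h. g (x + h)) has_fps_expansion F)"

section \<open>The stochastic differential equation\<close>

text \<open>The time index of a filtration is \<^typ>\<open>real\<close>; only the members at nonnegative times matter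
  (a filtration indexed by nonnegative times is extended constantly to the left).\<close>

definition filtered_prob_space :: "'a measure \<Rightarrow> (real \<Rightarrow> 'a measure) \<Rightarrow> bool" where
  "filtered_prob_space M F \<longleftrightarrow>
     prob_space M \<and> filtration (space M) F \<and> (\<forall>t. subalgebra M (F t))"

definition wiener_process ::
  "'a measure \<Rightarrow> (real \<Rightarrow> 'a measure) \<Rightarrow> (real \<Rightarrow> 'a \<Rightarrow> real) \<Rightarrow> bool" where
  "wiener_process M F W \<longleftrightarrow>
     filtered_prob_space M F \<and>
     (\<forall>t\<ge>0. W t \<in> borel_measurable (F t)) \<and>
     (\<forall>\<omega>\<in>space M. W 0 \<omega> = 0 \<and> continuous_on {0..} (\<lambda>t. W t \<omega>)) \<and>
     (\<forall>s t. 0 \<le> s \<and> s < t \<longrightarrow>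
        distributed M lborel (\<lambda>\<omega>. W t \<omega> - W s \<omega>) (normal_density 0 (sqrt (t - s))) \<and>
        prob_space.indep_set M (sets (F s))
          {(\<lambda>\<omega>. W t \<omega> - W s \<omega>) -` B \<inter> space M | B. B \<in> sets borel})"

definition progressively_measurable ::
  "(real \<Rightarrow> 'a measure) \<Rightarrow> real \<Rightarrow> (real \<Rightarrow> 'a \<Rightarrow> real) \<Rightarrow> bool" where
  "progressively_measurable F t H \<longleftrightarrow>
     (\<forall>r\<in>{0..t}. (\<lambda>(s, \<omega>). H s \<omega>) \<in> borel_measurable (restrict_space lborel {0..r} \<Otimes>\<^sub>M F r))"

text \<open>A simple integrand on \<open>[0,t]\<close> is given by grid points \<open>0 \<le> p 0 \<le> \<dots> \<le> p n \<le> t\<close> and bounded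
  \<open>F (p i)\<close>-measurable values \<open>\<xi> i\<close>, taken on \<open>(p i, p (i+1)]\<close>.\<close>

definition simple_integrand ::
  "'a measure \<Rightarrow> (real \<Rightarrow> 'a measure) \<Rightarrow> real \<Rightarrow> nat \<Rightarrow> (nat \<Rightarrow> real) \<Rightarrow> (nat \<Rightarrow> 'a \<Rightarrow> real) \<Rightarrow> bool"
  where
  "simple_integrand M F t n p \<xi> \<longleftrightarrow>
     0 \<le> p 0 \<and> (\<forall>i<n. p i \<le> p (Suc i)) \<and> p n \<le> t \<and>
     (\<forall>i<n. \<xi> i \<in> borel_measurable (F (p i)) \<and> (\<exists>K. \<forall>\<omega>\<in>space M. \<bar>\<xi> i \<omega>\<bar> \<le> K))"

definition simple_value :: "nat \<Rightarrow> (nat \<Rightarrow> real) \<Rightarrow> (nat \<Rightarrow> 'a \<Rightarrow> real) \<Rightarrow> real \<Rightarrow> 'a \<Rightarrow> real" where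
  "simple_value n p \<xi> s \<omega> = (\<Sum>i<n. \<xi> i \<omega> * indicator {p i<..p (Suc i)} s)"

definition simple_integral ::
  "(real \<Rightarrow> 'a \<Rightarrow> real) \<Rightarrow> nat \<Rightarrow> (nat \<Rightarrow> real) \<Rightarrow> (nat \<Rightarrow> 'a \<Rightarrow> real) \<Rightarrow> 'a \<Rightarrow> real" where
  "simple_integral W n p \<xi> \<omega> = (\<Sum>i<n. \<xi> i \<omega> * (W (p (Suc i)) \<omega> - W (p i) \<omega>))"

text \<open>\<open>I\<close> is (a version of) \<open>\<integral>\<^sub>0\<^sup>t H dW\<close>: simple integrands \<open>S j\<close> with \<open>\<integral>\<^sub>0\<^sup>t (S j - H)\<^sup>2 ds \<longlonglongrightarrow> 0\<close> in
  probability have elementary integrals converging to \<open>I\<close> in probability.  The pathwise time integral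
  is taken in \<^typ>\<open>ennreal\<close>, so that integrands which are not square integrable are not admitted.\<close>

definition has_ito_integral ::
  "'a measure \<Rightarrow> (real \<Rightarrow> 'a measure) \<Rightarrow> (real \<Rightarrow> 'a \<Rightarrow> real) \<Rightarrow> real \<Rightarrow>
   (real \<Rightarrow> 'a \<Rightarrow> real) \<Rightarrow> ('a \<Rightarrow> real) \<Rightarrow> bool" where
  "has_ito_integral M F W t H I \<longleftrightarrow>
     progressively_measurable F t H \<and> I \<in> borel_measurable M \<and>
     (\<exists>n p \<xi>. (\<forall>j. simple_integrand M F t (n j) (p j) (\<xi> j)) \<and>
        (\<forall>\<epsilon>>0. (\<lambda>j. measure M {\<omega>\<in>space M.
             (\<integral>\<^sup>+ s. ennreal ((simple_value (n j) (p j) (\<xi> j) s \<omega> - H s \<omega>)\<^sup>2) * indicator {0..t} s \<partial>lborel)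
               > ennreal \<epsilon>}) \<longlonglongrightarrow> 0) \<and>
        (\<forall>\<epsilon>>0. (\<lambda>j. measure M {\<omega>\<in>space M.
             \<bar>simple_integral W (n j) (p j) (\<xi> j) \<omega> - I \<omega>\<bar> > \<epsilon>}) \<longlonglongrightarrow> 0))"

definition ito_solution ::
  "'a measure \<Rightarrow> (real \<Rightarrow> 'a measure) \<Rightarrow> (real \<Rightarrow> 'a \<Rightarrow> real) \<Rightarrow> real \<Rightarrow>
   (real \<Rightarrow> real) \<Rightarrow> (real \<Rightarrow> real) \<Rightarrow> real \<Rightarrow> (real \<Rightarrow> 'a \<Rightarrow> real) \<Rightarrow> bool" where
  "ito_solution M F W T \<alpha> \<beta> u0 u \<longleftrightarrow>
     (\<forall>t\<in>{0..T}. u t \<in> borel_measurable (F t)) \<and>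
     (\<forall>\<omega>\<in>space M. continuous_on {0..T} (\<lambda>t. u t \<omega>)) \<and>
     (\<forall>t\<in>{0..T}. \<exists>I. has_ito_integral M F W t (\<lambda>s \<omega>. \<beta> (u s \<omega>)) I \<and>
        (AE \<omega> in M. u t \<omega> = u0 + (LINT s:{0..t}|lborel. \<alpha> (u s \<omega>)) + I \<omega>))"

definition unique_ito_solution ::
  "'a measure \<Rightarrow> (real \<Rightarrow> 'a measure) \<Rightarrow> (real \<Rightarrow> 'a \<Rightarrow> real) \<Rightarrow> real \<Rightarrow>
   (real \<Rightarrow> real) \<Rightarrow> (real \<Rightarrow> real) \<Rightarrow> real \<Rightarrow> (real \<Rightarrow> 'a \<Rightarrow> real) \<Rightarrow> bool" where
  "unique_ito_solution M F W T \<alpha> \<beta> u0 u \<longleftrightarrow>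
     ito_solution M F W T \<alpha> \<beta> u0 u \<and>
     (\<forall>v. ito_solution M F W T \<alpha> \<beta> u0 v \<longrightarrow> (AE \<omega> in M. \<forall>t\<in>{0..T}. v t \<omega> = u t \<omega>))"

section \<open>The formal expectation\<close>

definition generator :: "(real \<Rightarrow> real) \<Rightarrow> (real \<Rightarrow> real) \<Rightarrow> (real \<Rightarrow> real) \<Rightarrow> real \<Rightarrow> real" where
  "generator \<alpha> \<beta> g = (\<lambda>x. \<alpha> x * deriv g x + 1 / 2 * (\<beta> x)\<^sup>2 * deriv (deriv g) x)"

text \<open>As a formal series, \<open>\<bbbE>\<close>\<open>[f (u t)]\<close> is its Ito--Taylor series: iterating Ito's formula and taking
  expectations produces the following term of order \<open>k\<close>.\<close>

definition formal_expectation ::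
  "(real \<Rightarrow> real) \<Rightarrow> (real \<Rightarrow> real) \<Rightarrow> (real \<Rightarrow> real) \<Rightarrow> real \<Rightarrow> real \<Rightarrow> nat \<Rightarrow> real" where
  "formal_expectation \<alpha> \<beta> f u0 t k = t ^ k / fact k * ((generator \<alpha> \<beta> ^^ k) f) u0"

section \<open>Exotic coloured trees\<close>

datatype colour = Alpha | Beta

text \<open>An edge is a pair \<open>(e\<^sub>+, e\<^sub>-)\<close>, pointing from \<open>e\<^sub>-\<close> to its parent \<open>e\<^sub>+\<close>.  The value of
  \<open>colr\<close> at the root and outside the vertex set is irrelevant.  The exotic decoration is the
  partition of the \<open>Beta\<close>-vertices into its pairs.\<close>

record 'v ctree =
  verts :: "'v set"
  troot :: 'v
  edges :: "('v \<times> 'v) set"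
  colr :: "'v \<Rightarrow> colour"
  pairing :: "'v set set"

definition inner_verts :: "'v ctree \<Rightarrow> 'v set" where
  "inner_verts \<tau> = verts \<tau> - {troot \<tau>}"

definition verts_of :: "colour \<Rightarrow> 'v ctree \<Rightarrow> 'v set" where
  "verts_of c \<tau> = {v \<in> inner_verts \<tau>. colr \<tau> v = c}"

definition rooted_tree :: "'v ctree \<Rightarrow> bool" where
  "rooted_tree \<tau> \<longleftrightarrow>
     finite (verts \<tau>) \<and> troot \<tau> \<in> verts \<tau> \<and> edges \<tau> \<subseteq> verts \<tau> \<times> inner_verts \<tau> \<and>
     (\<forall>v\<in>inner_verts \<tau>. \<exists>!w. (w, v) \<in> edges \<tau>) \<and>
     (\<forall>v\<in>verts \<tau>. (troot \<tau>, v) \<in> (edges \<tau>)\<^sup>*)"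

definition exotic_tree :: "'v ctree \<Rightarrow> bool" where
  "exotic_tree \<tau> \<longleftrightarrow> rooted_tree \<tau> \<and>
     partition_on (verts_of Beta \<tau>) (pairing \<tau>) \<and> (\<forall>P\<in>pairing \<tau>. card P = 2)"

definition tree_iso :: "('v \<Rightarrow> 'w) \<Rightarrow> 'v ctree \<Rightarrow> 'w ctree \<Rightarrow> bool" where
  "tree_iso \<phi> \<tau> \<tau>' \<longleftrightarrow>
     bij_betw \<phi> (verts \<tau>) (verts \<tau>') \<and> \<phi> (troot \<tau>) = troot \<tau>' \<and>
     edges \<tau>' = map_prod \<phi> \<phi> ` edges \<tau> \<and>
     (\<forall>v\<in>inner_verts \<tau>. colr \<tau>' (\<phi> v) = colr \<tau> v) \<and>
     pairing \<tau>' = (`) \<phi> ` pairing \<tau>"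

text \<open>Every finite tree has a copy with vertices in \<^typ>\<open>nat\<close>, so it suffices to classify those.\<close>

definition iso_rel :: "(nat ctree \<times> nat ctree) set" where
  "iso_rel = {(\<tau>, \<tau>'). exotic_tree \<tau> \<and> exotic_tree \<tau>' \<and> (\<exists>\<phi>. tree_iso \<phi> \<tau> \<tau>')}"

lemma tree_iso_inner:
  assumes "tree_iso \<phi> \<tau> \<tau>'" "troot \<tau> \<in> verts \<tau>"
  shows "bij_betw \<phi> (inner_verts \<tau>) (inner_verts \<tau>')"
proof -
  have inj: "inj_on \<phi> (verts \<tau>)" and im: "\<phi> ` verts \<tau> = verts \<tau>'"
    and r: "\<phi> (troot \<tau>) = troot \<tau>'"
    using assms(1) by (auto simp: tree_iso_def bij_betw_def)
  have "\<phi> ` (verts \<tau> - {troot \<tau>}) = verts \<tau>' - {troot \<tau>'}"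
    using inj_on_image_set_diff[OF inj, of "verts \<tau>" "{troot \<tau>}"] assms(2) im r by simp
  then show ?thesis
    using inj by (auto simp: inner_verts_def bij_betw_def intro: inj_on_diff)
qed

lemma tree_iso_refl: "tree_iso (\<lambda>v. v) \<tau> \<tau>"
  by (auto simp: tree_iso_def map_prod_def bij_betw_def)

lemma tree_iso_comp:
  assumes "tree_iso \<phi> \<tau> \<tau>'" "tree_iso \<psi> \<tau>' \<tau>''" "troot \<tau> \<in> verts \<tau>"
  shows "tree_iso (\<psi> \<circ> \<phi>) \<tau> \<tau>''"
proof -
  have "\<phi> v \<in> inner_verts \<tau>'" if "v \<in> inner_verts \<tau>" for v
    using tree_iso_inner[OF assms(1,3)] that by (auto simp: bij_betw_def)
  then show ?thesis
    using assms unfolding tree_iso_def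
    by (auto intro: bij_betw_trans simp: image_comp map_prod.comp image_image)
qed

lemma tree_iso_inverse:
  assumes iso: "tree_iso \<phi> \<tau> \<tau>'" and "exotic_tree \<tau>"
  shows "tree_iso (inv_into (verts \<tau>) \<phi>) \<tau>' \<tau>"
proof -
  let ?\<psi> = "inv_into (verts \<tau>) \<phi>"
  have b: "bij_betw \<phi> (verts \<tau>) (verts \<tau>')"
    using iso by (simp add: tree_iso_def)
  have inv: "?\<psi> (\<phi> v) = v" if "v \<in> verts \<tau>" for v
    using b that by (simp add: bij_betw_def)
  have r: "troot \<tau> \<in> verts \<tau>"
    and e: "edges \<tau> \<subseteq> verts \<tau> \<times> verts \<tau>"
    and p: "\<And>P. P \<in> pairing \<tau> \<Longrightarrow> P \<subseteq> verts \<tau>"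
    using assms(2) by (auto simp: exotic_tree_def rooted_tree_def inner_verts_def partition_on_def
        verts_of_def)
  have "(\<lambda>x. map_prod ?\<psi> ?\<psi> (map_prod \<phi> \<phi> x)) ` edges \<tau> = (\<lambda>x. x) ` edges \<tau>"
    using e inv by (intro image_cong) auto
  then have "map_prod ?\<psi> ?\<psi> ` edges \<tau>' = edges \<tau>"
    using iso by (simp add: tree_iso_def image_image)
  moreover have "(`) ?\<psi> ` pairing \<tau>' = (\<lambda>P. P) ` pairing \<tau>"
    unfolding iso[unfolded tree_iso_def, THEN conjunct2, THEN conjunct2, THEN conjunct2, THEN conjunct2]
      image_image
  proof (rule image_cong)
    fix P assume "P \<in> pairing \<tau>"
    then have "(\<lambda>v. ?\<psi> (\<phi> v)) ` P = (\<lambda>v. v) ` P"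
      using p inv by (intro image_cong) auto
    then show "(\<lambda>v. ?\<psi> (\<phi> v)) ` P = P" by simp
  qed simp
  moreover have "colr \<tau> (?\<psi> w) = colr \<tau>' w" if "w \<in> inner_verts \<tau>'" for w
  proof -
    have "w \<in> \<phi> ` inner_verts \<tau>"
      using bij_betw_imp_surj_on[OF tree_iso_inner[OF iso r]] that by simp
    then obtain v where "v \<in> inner_verts \<tau>" "w = \<phi> v"
      by (rule imageE)
    then show ?thesis
      using iso inv[of v] by (simp add: tree_iso_def inner_verts_def)
  qed
  ultimately show ?thesis
    using iso inv[OF r] bij_betw_inv_into[OF b] by (simp add: tree_iso_def)
qed

lemma equiv_iso_rel: "equiv {\<tau>. exotic_tree \<tau>} iso_rel"
proof (rule equivI)
  show "iso_rel \<subseteq> {\<tau>. exotic_tree \<tau>} \<times> {\<tau>. exotic_tree \<tau>}"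
    by (auto simp: iso_rel_def)
  show "refl_on {\<tau>. exotic_tree \<tau>} iso_rel"
    unfolding refl_on_def iso_rel_def using tree_iso_refl by blast
  show "sym iso_rel"
  proof (rule symI)
    fix x y assume "(x, y) \<in> iso_rel"
    then obtain \<phi> where "exotic_tree x" "exotic_tree y" "tree_iso \<phi> x y"
      unfolding iso_rel_def by blast
    then show "(y, x) \<in> iso_rel"
      using tree_iso_inverse[of \<phi> x y] unfolding iso_rel_def by blast
  qed
  show "trans iso_rel"
  proof (rule transI)
    fix x y z assume "(x, y) \<in> iso_rel" "(y, z) \<in> iso_rel"
    then obtain \<phi> \<psi> where *: "exotic_tree x" "exotic_tree z" "tree_iso \<phi> x y" "tree_iso \<psi> y z"
      unfolding iso_rel_def by blast
    then have "tree_iso (\<psi> \<circ> \<phi>) x z"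
      by (intro tree_iso_comp) (simp_all add: exotic_tree_def rooted_tree_def)
    with * show "(x, z) \<in> iso_rel"
      unfolding iso_rel_def by blast
  qed
qed

definition exotic_trees :: "nat ctree set set" where
  "exotic_trees = {\<tau>. exotic_tree \<tau>} // iso_rel"

text \<open>All quantities below are isomorphism invariant, so they are evaluated at a representative.\<close>

definition rep :: "nat ctree set \<Rightarrow> nat ctree" where
  "rep C = (SOME \<tau>. \<tau> \<in> C)"

definition tree_order :: "'v ctree \<Rightarrow> nat" where
  "tree_order \<tau> = card (verts_of Alpha \<tau>) + card (verts_of Beta \<tau>) div 2 + 1"

definition num_children :: "'v ctree \<Rightarrow> 'v \<Rightarrow> nat" where
  "num_children \<tau> v = card {e \<in> edges \<tau>. fst e = v}"

text \<open>Automorphisms are maps on the vertex set only; \<open>permutes\<close> makes them the identity elsewhere.\<close>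

definition symmetry_factor :: "'v ctree \<Rightarrow> nat" where
  "symmetry_factor \<tau> = card {\<phi>. \<phi> permutes verts \<tau> \<and> tree_iso \<phi> \<tau> \<tau>}"

definition elem_diff ::
  "(real \<Rightarrow> real) \<Rightarrow> (real \<Rightarrow> real) \<Rightarrow> (real \<Rightarrow> real) \<Rightarrow> real \<Rightarrow> 'v ctree \<Rightarrow> real" where
  "elem_diff \<alpha> \<beta> f x \<tau> =
     (deriv ^^ num_children \<tau> (troot \<tau>)) f x *
     (\<Prod>v\<in>inner_verts \<tau>.
        (deriv ^^ num_children \<tau> v) (case colr \<tau> v of Alpha \<Rightarrow> \<alpha> | Beta \<Rightarrow> \<beta>) x)"

definition heaviside :: "real \<Rightarrow> real" where
  "heaviside x = (if x > 0 then 1 else 0)"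

text \<open>The Dirac deltas identify the times of paired vertices: the integration variables are indexed by
  the singletons of \<open>Alpha\<close>-vertices and the pairs of \<open>Beta\<close>-vertices, and a vertex carries the
  variable of the unique block containing it.\<close>

definition time_blocks :: "'v ctree \<Rightarrow> 'v set set" where
  "time_blocks \<tau> = (\<lambda>v. {v}) ` verts_of Alpha \<tau> \<union> pairing \<tau>"

definition block_of :: "'v ctree \<Rightarrow> 'v \<Rightarrow> 'v set" where
  "block_of \<tau> v = (THE b. b \<in> time_blocks \<tau> \<and> v \<in> b)"

text \<open>For the single root, the integral is over the one-point space (the empty product) and equals 1.\<close>

definition exotic_realization :: "real \<Rightarrow> real \<Rightarrow> 'v ctree \<Rightarrow> real" where
  "exotic_realization T t \<tau> =
     (\<integral>s. (\<Prod>e\<in>{e \<in> edges \<tau>. fst e = troot \<tau>}. heaviside (t - s (block_of \<tau> (snd e)))) *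
          (\<Prod>e\<in>{e \<in> edges \<tau>. fst e \<noteq> troot \<tau>}.
             heaviside (s (block_of \<tau> (fst e)) - s (block_of \<tau> (snd e))))
      \<partial>(Pi\<^sub>M (time_blocks \<tau>) (\<lambda>_. restrict_space lborel {0..T})))"

lemma exotic_realization_single_root:
  assumes "edges \<tau> = {}" "time_blocks \<tau> = {}"
  shows "exotic_realization T t \<tau> = 1"
  using assms by (simp add: exotic_realization_def PiM_empty)

end

theory Submission
  imports Defs "HOL-Combinatorics.Multiset_Permutations"
begin

text \<open>
  Both sides carry the factor \<open>t\<^sup>k / k!\<close> at order \<open>k\<close>; what remains is an identity between two ways of
  counting the trees that can be grown in \<open>k\<close> steps.

  \<^bold>\<open>The operator side.\<close>  Suppose a tree has elementary differential \<open>\<Upsilon>\<close>.  By the Leibniz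
  rule \<open>\<alpha> \<Upsilon>'\<close> is the sum, over all vertices, of the elementary differentials of the trees obtained by
  hanging a new \<open>\<alpha>\<close>-leaf on that vertex; likewise \<open>\<beta>\<^sup>2 \<Upsilon>''\<close> is the sum over all ordered pairs of
  vertices of what one gets by hanging a new pair of \<open>\<beta>\<close>-leaves on them.  Hence \<open>L\<^sup>k f\<close> is the sum of
  \<open>2\<^sup>-\<^sup>p \<Upsilon>\<close> over all \<^emph>\<open>growth histories\<close> of length \<open>k\<close>, where \<open>p\<close> counts the steps that add a pair
  (lemma \<open>generator_power_eq_sum_histories\<close>).

  \<^bold>\<open>The integral side.\<close>  Up to a null set the times of the \<open>k\<close> blocks are pairwise distinct, so the
  cube \<open>[0,t)\<^sup>k\<close> is the disjoint union of \<open>k!\<close> regions, one for each ordering of the blocks, each of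
  volume \<open>t\<^sup>k / k!\<close>.  The integrand equals 1 on a region if every block comes earlier in time than the
  blocks of the parents of its vertices, and 0 otherwise.  The integral is therefore \<open>t\<^sup>k / k!\<close> times
  the number of linear extensions (lemma \<open>exotic_realization_eq\<close>).  A tree in which a block
  would have to precede itself has no linear extension and contributes nothing.

  \<^bold>\<open>The bridge.\<close>  Fix a tree \<open>\<tau>\<close> with \<open>p\<close> pairs.  A growth history together with an isomorphism from
  the grown tree onto \<open>\<tau>\<close> is the same thing as a linear extension of \<open>\<tau>\<close> together with an order on each
  of its pairs: the history records which block appears when, the isomorphism says which vertex it is.
  There are \<open>2\<^sup>p\<close> times as many of the latter as there are linear extensions; the former number
  \<open>\<sigma>(\<tau>)\<close> for each history that grows a copy of \<open>\<tau>\<close>.  So the histories growing a copy of \<open>\<tau>\<close>, weighted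
  by \<open>2\<^sup>-\<^sup>p\<close>, count the linear extensions divided by \<open>\<sigma>(\<tau>)\<close>
  (lemma \<open>card_histories_of_class\<close>), and grouping histories by isomorphism class gives the theorem.
\<close>

section \<open>Blocks of an exotic tree\<close>

lemma verts_of_Alpha_Un_Beta: "verts_of Alpha \<tau> \<union> verts_of Beta \<tau> = inner_verts \<tau>"
  by (auto simp: verts_of_def intro: colour.exhaust)

lemma partition_on_time_blocks:
  assumes "exotic_tree \<tau>"
  shows "partition_on (inner_verts \<tau>) (time_blocks \<tau>)"
proof -
  have beta: "partition_on (verts_of Beta \<tau>) (pairing \<tau>)"
    using assms by (simp add: exotic_tree_def)
  have disj: "verts_of Alpha \<tau> \<inter> verts_of Beta \<tau> = {}"
    by (auto simp: verts_of_def)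
  show ?thesis
  proof (rule partition_onI)
    show "\<Union> (time_blocks \<tau>) = inner_verts \<tau>"
      using partition_onD1[OF beta] verts_of_Alpha_Un_Beta[of \<tau>] by (auto simp: time_blocks_def)
    show "{} \<notin> time_blocks \<tau>"
      using partition_onD3[OF beta] by (auto simp: time_blocks_def)
    show "disjnt p q" if "p \<in> time_blocks \<tau>" "q \<in> time_blocks \<tau>" "p \<noteq> q" for p q
    proof -
      have sub: "v \<notin> P" if "P \<in> pairing \<tau>" "v \<in> verts_of Alpha \<tau>" for P v
        using that partition_onD1[OF beta] disj by auto
      have dis: "P = Q" if "P \<in> pairing \<tau>" "Q \<in> pairing \<tau>" "v \<in> P" "v \<in> Q" for P Q v
        using that partition_onD2[OF beta] by (auto simp: disjoint_def)
      show ?thesis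
        using that sub dis by (fastforce simp: time_blocks_def disjnt_def)
    qed
  qed
qed

lemma block_of_eqI:
  assumes "exotic_tree \<tau>" "b \<in> time_blocks \<tau>" "v \<in> b"
  shows "block_of \<tau> v = b"
  unfolding block_of_def
proof (rule the_equality)
  fix b' assume "b' \<in> time_blocks \<tau> \<and> v \<in> b'"
  then show "b' = b"
    using partition_onD2[OF partition_on_time_blocks[OF assms(1)]] assms(2,3)
    by (auto simp: disjoint_def)
qed (use assms in simp)

lemma block_of:
  assumes "exotic_tree \<tau>" "v \<in> inner_verts \<tau>"
  shows "block_of \<tau> v \<in> time_blocks \<tau>" "v \<in> block_of \<tau> v"
proof -
  obtain b where "b \<in> time_blocks \<tau>" "v \<in> b"
    using partition_onD1[OF partition_on_time_blocks[OF assms(1)]] assms(2) by auto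
  then show "block_of \<tau> v \<in> time_blocks \<tau>" "v \<in> block_of \<tau> v"
    using block_of_eqI[OF assms(1)] by auto
qed

lemma exotic_tree_root: "exotic_tree \<tau> \<Longrightarrow> troot \<tau> \<in> verts \<tau>"
  by (simp add: exotic_tree_def rooted_tree_def)

lemma exotic_tree_finite:
  assumes "exotic_tree \<tau>"
  shows "finite (inner_verts \<tau>)" "finite (edges \<tau>)" "finite (time_blocks \<tau>)" "finite (pairing \<tau>)"
proof -
  show 1: "finite (inner_verts \<tau>)"
    using assms by (simp add: exotic_tree_def rooted_tree_def inner_verts_def)
  show "finite (edges \<tau>)"
    using assms 1 by (auto simp: exotic_tree_def rooted_tree_def intro: finite_subset)
  show "finite (time_blocks \<tau>)"
    using finite_elements[OF 1 partition_on_time_blocks[OF assms]] .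
  then show "finite (pairing \<tau>)"
    by (simp add: time_blocks_def)
qed

lemma exotic_tree_edges:
  assumes "exotic_tree \<tau>" "(v, w) \<in> edges \<tau>"
  shows "w \<in> inner_verts \<tau>" "v \<noteq> troot \<tau> \<Longrightarrow> v \<in> inner_verts \<tau>"
  using assms by (auto simp: exotic_tree_def rooted_tree_def inner_verts_def)

lemma unique_parent:
  assumes "exotic_tree \<tau>" "(u, w) \<in> edges \<tau>" "(u', w) \<in> edges \<tau>"
  shows "u = u'"
proof -
  have "w \<in> inner_verts \<tau>" using assms(1,2) exotic_tree_edges by fast
  then have "\<exists>!u. (u, w) \<in> edges \<tau>" using assms(1) by (auto simp: exotic_tree_def rooted_tree_def)
  with assms(2,3) show ?thesis by auto
qed

lemma pairing_subset_Beta: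
  "exotic_tree \<tau> \<Longrightarrow> P \<in> pairing \<tau> \<Longrightarrow> P \<subseteq> verts_of Beta \<tau>"
  using partition_onD1[of "verts_of Beta \<tau>" "pairing \<tau>"] by (auto simp: exotic_tree_def)

lemma pairing_unique:
  assumes "exotic_tree \<tau>" "P \<in> pairing \<tau>" "Q \<in> pairing \<tau>" "v \<in> P" "v \<in> Q"
  shows "P = Q"
  using block_of_eqI[OF assms(1), of P v] block_of_eqI[OF assms(1), of Q v] assms(2-)
  by (simp add: time_blocks_def)

text \<open>Blocks are pairwise disjoint and nonempty, so leaving one out would uncover its vertices.\<close>

lemma time_blocks_eq_if_Union:
  assumes "exotic_tree \<tau>" "B \<subseteq> time_blocks \<tau>" "\<Union> B = inner_verts \<tau>"
  shows "B = time_blocks \<tau>"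
proof (intro equalityI assms(2) subsetI)
  fix b assume b: "b \<in> time_blocks \<tau>"
  then obtain v where v: "v \<in> b"
    using partition_onD3[OF partition_on_time_blocks[OF assms(1)]] by fastforce
  then have "v \<in> \<Union> B"
    using b assms(3) partition_onD1[OF partition_on_time_blocks[OF assms(1)]] by auto
  then obtain b' where "b' \<in> B" "v \<in> b'" by auto
  then show "b \<in> B"
    using block_of_eqI[OF assms(1) b v] block_of_eqI[OF assms(1), of b' v] assms(2) by auto
qed

lemma card_Beta_eq:
  assumes "exotic_tree \<tau>"
  shows "card (verts_of Beta \<tau>) = 2 * card (pairing \<tau>)"
proof -
  have part: "partition_on (verts_of Beta \<tau>) (pairing \<tau>)" and two: "\<forall>P\<in>pairing \<tau>. card P = 2"
    using assms by (auto simp: exotic_tree_def)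
  have "card (\<Union> (pairing \<tau>)) = 2 * card (pairing \<tau>)"
    using partition_onD2[OF part] two
    by (subst card_Union_disjoint) (auto intro: card_ge_0_finite)
  then show ?thesis
    using partition_onD1[OF part] by simp
qed

lemma card_time_blocks:
  assumes "exotic_tree \<tau>"
  shows "card (time_blocks \<tau>) = card (verts_of Alpha \<tau>) + card (pairing \<tau>)"
proof -
  have "{v} \<notin> pairing \<tau>" for v
    using assms by (force simp: exotic_tree_def)
  then have "(\<lambda>v. {v}) ` verts_of Alpha \<tau> \<inter> pairing \<tau> = {}"
    by auto
  moreover have "finite (verts_of Alpha \<tau>)"
    using exotic_tree_finite(1)[OF assms] by (simp add: verts_of_def)
  ultimately show ?thesis
    using exotic_tree_finite(4)[OF assms]
    by (simp add: time_blocks_def card_Un_disjoint card_image inj_on_def)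
qed

lemma tree_order_eq: "exotic_tree \<tau> \<Longrightarrow> tree_order \<tau> = card (time_blocks \<tau>) + 1"
  by (simp add: tree_order_def card_Beta_eq card_time_blocks)

section \<open>Growth histories\<close>

text \<open>One step of a growth history; the arguments are the vertices on which the new leaves are hung.
  For a pair their order matters: a second derivative runs over ordered pairs of vertices, and the
  factor \<open>1/2\<close> of the generator becomes the weight of the step.\<close>

datatype growth = GrowAlpha nat | GrowBeta nat nat

text \<open>Histories are lists with the newest step first, so that growing is recursion on the list.\<close>

primrec num_verts :: "growth list \<Rightarrow> nat" where
  "num_verts [] = 1"
| "num_verts (g # h) = (case g of GrowAlpha a \<Rightarrow> num_verts h + 1 | GrowBeta a b \<Rightarrow> num_verts h + 2)"

text \<open>The vertices are numbered consecutively in order of creation, starting with the root 0, so the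
  next free vertex is always \<^const>\<open>num_verts\<close>.  Colours default to \<^const>\<open>Alpha\<close> at the root and
  outside the tree.\<close>

primrec grown :: "growth list \<Rightarrow> nat ctree" where
  "grown [] = \<lparr>verts = {0}, troot = 0, edges = {}, colr = (\<lambda>_. Alpha), pairing = {}\<rparr>"
| "grown (g # h) = (let \<tau> = grown h; n = num_verts h in
     case g of
       GrowAlpha a \<Rightarrow> \<lparr>verts = insert n (verts \<tau>), troot = 0, edges = insert (a, n) (edges \<tau>),
          colr = (colr \<tau>)(n := Alpha), pairing = pairing \<tau>\<rparr>
     | GrowBeta a b \<Rightarrow> \<lparr>verts = insert n (insert (Suc n) (verts \<tau>)), troot = 0,
          edges = insert (a, n) (insert (b, Suc n) (edges \<tau>)),
          colr = (colr \<tau>)(n := Beta, Suc n := Beta), pairing = insert {n, Suc n} (pairing \<tau>)\<rparr>)"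

definition growths :: "nat \<Rightarrow> growth set" where
  "growths n = GrowAlpha ` {..<n} \<union> case_prod GrowBeta ` ({..<n} \<times> {..<n})"

primrec histories :: "nat \<Rightarrow> growth list set" where
  "histories 0 = {[]}"
| "histories (Suc k) = (\<lambda>(h, g). g # h) ` (SIGMA h:histories k. growths (num_verts h))"

lemma finite_growths: "finite (growths n)"
  by (simp add: growths_def)

lemma finite_histories: "finite (histories k)"
  by (induction k) (auto intro!: finite_imageI finite_SigmaI finite_growths)

lemma sum_growths:
  "(\<Sum>g\<in>growths n. F g) = (\<Sum>a<n. F (GrowAlpha a)) + (\<Sum>a<n. \<Sum>b<n. F (GrowBeta a b))" for F :: "growth \<Rightarrow> real"
proof -
  have "(\<Sum>g\<in>growths n. F g) =
      sum F (GrowAlpha ` {..<n}) + sum F (case_prod GrowBeta ` ({..<n} \<times> {..<n}))"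
    unfolding growths_def by (rule sum.union_disjoint) auto
  also have "sum F (GrowAlpha ` {..<n}) = (\<Sum>a<n. F (GrowAlpha a))"
    by (subst sum.reindex) (auto simp: inj_on_def)
  also have "sum F (case_prod GrowBeta ` ({..<n} \<times> {..<n})) = (\<Sum>a<n. \<Sum>b<n. F (GrowBeta a b))"
    by (subst sum.reindex) (auto simp: inj_on_def sum.cartesian_product split_def)
  finally show ?thesis .
qed

lemma sum_histories_Suc:
  "(\<Sum>h\<in>histories (Suc k). F h) = (\<Sum>h\<in>histories k. \<Sum>g\<in>growths (num_verts h). F (g # h))"
  for F :: "growth list \<Rightarrow> real"
  by (simp add: sum.Sigma finite_histories finite_growths sum.reindex inj_on_def split_def)

text \<open>These equations hold for arbitrary lists of steps, also for those that refer to vertices not yet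
  created; \<^const>\<open>histories\<close> excludes the latter.\<close>

lemma grown_simps:
  shows "verts (grown h) = {..<num_verts h}" and "troot (grown h) = 0" and "num_verts h > 0"
proof -
  show "num_verts h > 0"
    by (induction h) (simp_all split: growth.split)
  show "troot (grown h) = 0"
    by (cases h) (simp_all add: Let_def split: growth.split)
  show "verts (grown h) = {..<num_verts h}"
    by (induction h) (simp_all add: Let_def lessThan_Suc insert_commute split: growth.split)
qed

lemma edges_grown_bound:
  "h \<in> histories k \<Longrightarrow> edges (grown h) \<subseteq> {..<num_verts h} \<times> {0<..<num_verts h}"
proof (induction k arbitrary: h)
  case (Suc k)
  then obtain g h' where h: "h = g # h'" "h' \<in> histories k" "g \<in> growths (num_verts h')"
    by auto
  show ?case
    using Suc.IH[OF h(2)] h(3) grown_simps(3)[of h'] unfolding h(1)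
    by (cases g) (auto simp: growths_def Let_def)
qed simp

lemma finite_edges_grown: "finite (edges (grown h))"
  by (induction h) (auto simp: Let_def split: growth.split)

lemma pairing_grown_bound: "P \<in> pairing (grown h) \<Longrightarrow> P \<subseteq> {0<..<num_verts h}"
proof (induction h)
  case (Cons g h)
  then show ?case
    using grown_simps(3)[of h] by (cases g) (fastforce simp: Let_def)+
qed simp

lemma finite_pairing_grown: "finite (pairing (grown h))"
  by (induction h) (auto simp: Let_def split: growth.split)

lemma card_pairing_grown:
  "card (pairing (grown (GrowAlpha a # h))) = card (pairing (grown h))"
  "card (pairing (grown (GrowBeta a b # h))) = Suc (card (pairing (grown h)))"
proof -
  have "{num_verts h, Suc (num_verts h)} \<notin> pairing (grown h)"
    using pairing_grown_bound by fastforce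
  then show "card (pairing (grown (GrowBeta a b # h))) = Suc (card (pairing (grown h)))"
    by (simp add: finite_pairing_grown Let_def)
qed (simp add: Let_def)

lemma rooted_tree_add_leaf:
  assumes "rooted_tree \<tau>" "a \<in> verts \<tau>" "n \<notin> verts \<tau>"
    "verts \<tau>' = insert n (verts \<tau>)" "troot \<tau>' = troot \<tau>" "edges \<tau>' = insert (a, n) (edges \<tau>)"
  shows "rooted_tree \<tau>'"
proof -
  let ?r = "troot \<tau>"
  have \<tau>: "finite (verts \<tau>)" "?r \<in> verts \<tau>" "edges \<tau> \<subseteq> verts \<tau> \<times> inner_verts \<tau>"
    "\<And>v. v \<in> inner_verts \<tau> \<Longrightarrow> \<exists>!w. (w, v) \<in> edges \<tau>"
    "\<And>v. v \<in> verts \<tau> \<Longrightarrow> (?r, v) \<in> (edges \<tau>)\<^sup>*"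
    using assms(1) by (auto simp: rooted_tree_def)
  have inner: "inner_verts \<tau>' = insert n (inner_verts \<tau>)" "n \<notin> inner_verts \<tau>"
    using assms \<tau>(2) by (auto simp: inner_verts_def)
  have sub: "(edges \<tau>)\<^sup>* \<subseteq> (edges \<tau>')\<^sup>*"
    using assms(6) by (intro rtrancl_mono) auto
  have "\<exists>!w. (w, v) \<in> edges \<tau>'" if v: "v \<in> inner_verts \<tau>'" for v
  proof (cases "v = n")
    case True
    with assms(3,6) \<tau>(3) show ?thesis by (auto simp: inner_verts_def)
  next
    case False
    with v inner(1) have "v \<in> inner_verts \<tau>" by auto
    from \<tau>(4)[OF this] False assms(6) show ?thesis by auto
  qed
  moreover have "(?r, v) \<in> (edges \<tau>')\<^sup>*" if v: "v \<in> verts \<tau>'" for v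
  proof (cases "v = n")
    case True
    have "(?r, a) \<in> (edges \<tau>')\<^sup>*" using \<tau>(5)[OF assms(2)] sub by auto
    moreover have "(a, n) \<in> edges \<tau>'" using assms(6) by simp
    ultimately show ?thesis unfolding True by (rule rtrancl.rtrancl_into_rtrancl)
  next
    case False
    with v assms(4) \<tau>(5) sub show ?thesis by auto
  qed
  ultimately show ?thesis
    using assms \<tau>(1-3) inner by (auto simp: rooted_tree_def)
qed

text \<open>A pair of \<open>\<beta>\<close>-leaves is added one leaf at a time; the leaf's colour and pairing are invisible to
  \<^const>\<open>rooted_tree\<close>, so the intermediate tree may be taken to be the one with an \<open>\<alpha>\<close>-leaf.\<close>

lemma rooted_tree_grown:
  "h \<in> histories k \<Longrightarrow> rooted_tree (grown h)"
proof (induction k arbitrary: h)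
  case 0
  then show ?case by (simp add: rooted_tree_def inner_verts_def)
next
  case (Suc k)
  then obtain g h' where h: "h = g # h'" "h' \<in> histories k" "g \<in> growths (num_verts h')"
    by auto
  have IH: "rooted_tree (grown h')" using Suc.IH h by blast
  have *: "rooted_tree (grown (GrowAlpha a # h'))" if "a < num_verts h'" for a
    using that by (intro rooted_tree_add_leaf[OF IH, of a "num_verts h'"])
      (auto simp: Let_def grown_simps(1) grown_simps(2)[of h'])
  show ?case
  proof (cases g)
    case (GrowAlpha a)
    with h * show ?thesis by (auto simp: growths_def simp del: grown.simps)
  next
    case (GrowBeta a b)
    with h have ab: "a < num_verts h'" "b < num_verts h'" by (auto simp: growths_def)
    show ?thesis
      unfolding h(1) GrowBeta using ab
      by (intro rooted_tree_add_leaf[OF *[OF ab(1)], of b "Suc (num_verts h')"])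
        (auto simp: Let_def grown_simps(1))
  qed
qed

lemma verts_of_grown:
  "verts_of c (grown (GrowAlpha a # h)) = (if c = Alpha then {num_verts h} else {}) \<union> verts_of c (grown h)"
  "verts_of c (grown (GrowBeta a b # h)) =
     (if c = Beta then {num_verts h, Suc (num_verts h)} else {}) \<union> verts_of c (grown h)"
  using grown_simps(3)[of h]
  by (cases c; auto simp: verts_of_def inner_verts_def Let_def grown_simps(1) grown_simps(2)[of h])+

lemma verts_of_grown_less: "v \<in> verts_of c (grown h) \<Longrightarrow> v < num_verts h"
  by (auto simp: verts_of_def inner_verts_def grown_simps)

lemma exotic_tree_grown:
  assumes "h \<in> histories k"
  shows "exotic_tree (grown h)"
proof -
  have "partition_on (verts_of Beta (grown h)) (pairing (grown h)) \<and> (\<forall>P\<in>pairing (grown h). card P = 2)"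
  proof (induction h)
    case Nil
    show ?case by (simp add: verts_of_def inner_verts_def partition_on_def)
  next
    case (Cons g h)
    show ?case
    proof (cases g)
      case (GrowAlpha a)
      with Cons show ?thesis by (simp add: verts_of_grown del: grown.simps) (simp add: Let_def)
    next
      case (GrowBeta a b)
      let ?P = "{num_verts h, Suc (num_verts h)}"
      have "disjnt ?P P" if "P \<in> pairing (grown h)" for P
        using pairing_grown_bound[OF that] by (auto simp: disjnt_def)
      with Cons have "partition_on (?P \<union> verts_of Beta (grown h)) (insert ?P (pairing (grown h)))"
        by (auto simp: partition_on_def disjoint_def disjnt_def)
      moreover have "pairing (grown (GrowBeta a b # h)) = insert ?P (pairing (grown h))"
        by (simp add: Let_def)
      ultimately show ?thesis
        using Cons GrowBeta by (simp add: verts_of_grown del: grown.simps)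
    qed
  qed
  then show ?thesis
    using rooted_tree_grown[OF assms] by (simp add: exotic_tree_def)
qed

lemma card_time_blocks_grown:
  "h \<in> histories k \<Longrightarrow> card (time_blocks (grown h)) = k"
proof (induction k arbitrary: h)
  case 0
  then show ?case by (simp add: time_blocks_def verts_of_def inner_verts_def)
next
  case (Suc k)
  from Suc.prems obtain g h' where h: "h = g # h'" "h' \<in> histories k"
    by auto
  have fin: "finite (verts_of c (grown h'))" for c
    using exotic_tree_finite(1)[OF exotic_tree_grown[OF h(2)]] by (simp add: verts_of_def)
  have new: "num_verts h' \<notin> verts_of c (grown h')" for c
    using verts_of_grown_less[of "num_verts h'" c h'] by auto
  show ?case
    using Suc.IH[OF h(2)] exotic_tree_grown[OF h(2)] exotic_tree_grown[OF Suc.prems] fin new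
    unfolding h(1)
    by (cases g) (simp_all add: card_time_blocks verts_of_grown card_pairing_grown del: grown.simps)
qed

lemma tree_order_grown: "h \<in> histories k \<Longrightarrow> tree_order (grown h) = k + 1"
  by (simp add: tree_order_eq exotic_tree_grown card_time_blocks_grown)

section \<open>Powers of the generator\<close>

lemma num_children_insert:
  assumes "finite (edges \<tau>)" "(a, w) \<notin> edges \<tau>" "edges \<tau>' = insert (a, w) (edges \<tau>)"
  shows "num_children \<tau>' = (num_children \<tau>)(a := Suc (num_children \<tau> a))"
proof
  fix v
  have "{e \<in> edges \<tau>'. fst e = v} =
      (if v = a then insert (a, w) {e \<in> edges \<tau>. fst e = v} else {e \<in> edges \<tau>. fst e = v})"
    using assms(3) by auto
  then show "num_children \<tau>' v = ((num_children \<tau>)(a := Suc (num_children \<tau> a))) v"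
    using assms(1,2) by (simp add: num_children_def)
qed

lemma num_children_grown:
  assumes "h \<in> histories k"
  shows "num_children (grown (GrowAlpha a # h)) =
      (num_children (grown h))(a := Suc (num_children (grown h) a))"
    and "num_children (grown (GrowBeta a b # h)) = (let m = num_children (grown h);
      m' = m(a := Suc (m a)) in m'(b := Suc (m' b)))"
proof -
  let ?n = "num_verts h"
  have new: "(a, ?n) \<notin> edges (grown h)" "(b, Suc ?n) \<notin> edges (grown h)"
    for a b using edges_grown_bound[OF assms] by auto
  show 1: "num_children (grown (GrowAlpha a # h)) =
      (num_children (grown h))(a := Suc (num_children (grown h) a))"
    by (rule num_children_insert) (auto simp: finite_edges_grown new Let_def)
  have "num_children (grown (GrowBeta a b # h)) =
      (num_children (grown (GrowAlpha a # h)))(b := Suc (num_children (grown (GrowAlpha a # h)) b))"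
    by (rule num_children_insert[where w = "Suc ?n"]) (auto simp: finite_edges_grown new Let_def)
  with 1 show "num_children (grown (GrowBeta a b # h)) = (let m = num_children (grown h);
      m' = m(a := Suc (m a)) in m'(b := Suc (m' b)))"
    by (simp add: Let_def)
qed

lemma num_children_grown_outside:
  "h \<in> histories k \<Longrightarrow> v \<ge> num_verts h \<Longrightarrow> num_children (grown h) v = 0"
  using edges_grown_bound[of h k] by (force simp: num_children_def card_eq_0_iff)

text \<open>Elementary differentials as functions of the numbers of children alone.  Freeing these numbers
  from the tree lets the Leibniz rule raise them one at a time.\<close>

definition deriv_prod :: "nat \<Rightarrow> (nat \<Rightarrow> nat) \<Rightarrow> (nat \<Rightarrow> real \<Rightarrow> real) \<Rightarrow> real \<Rightarrow> real" where
  "deriv_prod n m g x = (\<Prod>v<n. (deriv ^^ m v) (g v) x)"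

text \<open>The Leibniz rule: differentiating hits one factor at a time, which has the same effect on the
  exponents as giving that vertex one more child.\<close>

lemma has_field_derivative_deriv_prod:
  assumes "\<And>v. v < n \<Longrightarrow> smooth_fun (g v)"
  shows "(deriv_prod n m g has_field_derivative
           (\<Sum>a<n. deriv_prod n (m(a := Suc (m a))) g x)) (at x)"
  using assms
proof (induction n)
  case 0
  then show ?case by (simp add: deriv_prod_def)
next
  case (Suc n)
  have *: "(deriv_prod n m g has_field_derivative
      (\<Sum>a<n. deriv_prod n (m(a := Suc (m a))) g x)) (at x)"
    by (rule Suc.IH) (simp add: Suc.prems)
  have "((deriv ^^ m n) (g n) has_field_derivative deriv ((deriv ^^ m n) (g n)) x) (at x)"
    using Suc.prems[of n] by (simp add: smooth_fun_def field_differentiable_derivI)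
  with * have "((\<lambda>x. deriv_prod n m g x * (deriv ^^ m n) (g n) x) has_field_derivative
      (\<Sum>a<n. deriv_prod n (m(a := Suc (m a))) g x) * (deriv ^^ m n) (g n) x +
      deriv ((deriv ^^ m n) (g n)) x * deriv_prod n m g x) (at x)"
    by (rule DERIV_mult)
  moreover have "deriv_prod (Suc n) m g = (\<lambda>x. deriv_prod n m g x * (deriv ^^ m n) (g n) x)"
    by (simp add: deriv_prod_def fun_eq_iff)
  moreover have "(\<Sum>a<Suc n. deriv_prod (Suc n) (m(a := Suc (m a))) g x) =
      (\<Sum>a<n. deriv_prod n (m(a := Suc (m a))) g x * (deriv ^^ m n) (g n) x) +
      deriv_prod n m g x * deriv ((deriv ^^ m n) (g n)) x"
    unfolding sum.lessThan_Suc by (intro arg_cong2[where f = plus] sum.cong) (auto simp: deriv_prod_def)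
  ultimately show ?case
    by (simp only: sum_distrib_left mult.commute)
qed

text \<open>The root of a history's tree carries \<open>f\<close>, whatever colour is recorded there.\<close>

definition vertex_fun ::
  "(real \<Rightarrow> real) \<Rightarrow> (real \<Rightarrow> real) \<Rightarrow> (real \<Rightarrow> real) \<Rightarrow> growth list \<Rightarrow> nat \<Rightarrow> real \<Rightarrow> real" where
  "vertex_fun \<alpha> \<beta> f h v =
     (if v = 0 then f else case colr (grown h) v of Alpha \<Rightarrow> \<alpha> | Beta \<Rightarrow> \<beta>)"

lemma elem_diff_grown:
  "elem_diff \<alpha> \<beta> f x (grown h) =
     deriv_prod (num_verts h) (num_children (grown h)) (vertex_fun \<alpha> \<beta> f h) x"
proof -
  have "{..<num_verts h} = insert 0 (inner_verts (grown h))"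
    using grown_simps[of h] by (auto simp: inner_verts_def)
  moreover have "0 \<notin> inner_verts (grown h)" "finite (inner_verts (grown h))"
    by (simp_all add: inner_verts_def grown_simps)
  ultimately have "deriv_prod (num_verts h) (num_children (grown h)) (vertex_fun \<alpha> \<beta> f h) x =
      (deriv ^^ num_children (grown h) 0) f x * (\<Prod>v\<in>inner_verts (grown h).
        (deriv ^^ num_children (grown h) v) (vertex_fun \<alpha> \<beta> f h v) x)"
    by (simp add: deriv_prod_def vertex_fun_def)
  also have "\<dots> = elem_diff \<alpha> \<beta> f x (grown h)"
    unfolding elem_diff_def grown_simps(2) using \<open>0 \<notin> inner_verts (grown h)\<close>
    by (intro arg_cong2[where f = times] prod.cong refl) (metis vertex_fun_def)
  finally show ?thesis by simp
qed

lemma elem_diff_GrowAlpha: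
  assumes "h \<in> histories k" "a < num_verts h"
  shows "elem_diff \<alpha> \<beta> f x (grown (GrowAlpha a # h)) = \<alpha> x * deriv_prod (num_verts h)
    ((num_children (grown h))(a := Suc (num_children (grown h) a))) (vertex_fun \<alpha> \<beta> f h) x"
proof -
  let ?n = "num_verts h" and ?m = "(num_children (grown h))(a := Suc (num_children (grown h) a))"
  have "?m ?n = 0"
    using assms num_children_grown_outside by fastforce
  moreover have "vertex_fun \<alpha> \<beta> f (GrowAlpha a # h) v = vertex_fun \<alpha> \<beta> f h v" if "v < ?n" for v
    using that by (simp add: vertex_fun_def Let_def)
  moreover have "vertex_fun \<alpha> \<beta> f (GrowAlpha a # h) ?n = \<alpha>"
    using grown_simps(3)[of h] by (simp add: vertex_fun_def Let_def)
  ultimately show ?thesis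
    by (simp add: elem_diff_grown num_children_grown[OF assms(1)] deriv_prod_def del: grown.simps)
qed

text \<open>Both new vertices are childless, so each contributes a factor \<open>\<beta>\<close>.  If \<open>a = b\<close>, that vertex
  gains two children; the two updates therefore have to be made one after the other.\<close>

lemma elem_diff_GrowBeta:
  assumes "h \<in> histories k" "a < num_verts h" "b < num_verts h"
  shows "elem_diff \<alpha> \<beta> f x (grown (GrowBeta a b # h)) = (\<beta> x)\<^sup>2 * deriv_prod (num_verts h)
    (let m = num_children (grown h); m' = m(a := Suc (m a)) in m'(b := Suc (m' b)))
    (vertex_fun \<alpha> \<beta> f h) x"
proof -
  let ?n = "num_verts h"
  let ?m = "let m = num_children (grown h); m' = m(a := Suc (m a)) in m'(b := Suc (m' b))"
  have "?m ?n = 0" "?m (Suc ?n) = 0"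
    using assms num_children_grown_outside[OF assms(1)] by (simp_all add: Let_def)
  moreover have "vertex_fun \<alpha> \<beta> f (GrowBeta a b # h) v = vertex_fun \<alpha> \<beta> f h v" if "v < ?n" for v
    using that by (simp add: vertex_fun_def Let_def)
  moreover have "vertex_fun \<alpha> \<beta> f (GrowBeta a b # h) ?n = \<beta>"
    "vertex_fun \<alpha> \<beta> f (GrowBeta a b # h) (Suc ?n) = \<beta>"
    using grown_simps(3)[of h] by (simp_all add: vertex_fun_def Let_def)
  ultimately show ?thesis
    by (simp add: elem_diff_grown num_children_grown[OF assms(1)] deriv_prod_def
        power2_eq_square del: grown.simps)
qed

text \<open>Applying the generator to the elementary differential of a grown tree adds one more step to its
  history in every possible way.  In \<open>\<beta>\<^sup>2 \<Upsilon>''\<close> the derivatives do not act on the new factor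
  \<open>\<beta>\<^sup>2\<close>, in agreement with a pair being hung only on vertices that are older than both of its
  members.\<close>

lemma generator_power_eq_sum_histories:
  assumes "smooth_fun \<alpha>" "smooth_fun \<beta>" "smooth_fun f"
  shows "(generator \<alpha> \<beta> ^^ k) f =
    (\<lambda>x. \<Sum>h\<in>histories k. (1/2) ^ card (pairing (grown h)) * elem_diff \<alpha> \<beta> f x (grown h))"
proof (induction k)
  case 0
  show ?case
    by (simp add: elem_diff_def num_children_def inner_verts_def)
next
  case (Suc k)
  let ?w = "\<lambda>h. (1/2) ^ card (pairing (grown h)) :: real"
  let ?n = num_verts and ?m = "\<lambda>h. num_children (grown h)" and ?g = "vertex_fun \<alpha> \<beta> f"
  \<comment> \<open>Numbers of children after one and after two derivatives have been taken.\<close>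
  define m1 where "m1 h a = (?m h)(a := Suc (?m h a))" for h a
  define m2 where "m2 h a b = (m1 h a)(b := Suc (m1 h a b))" for h a b
  have smooth: "smooth_fun (?g h v)" for h v
    using assms by (auto simp: vertex_fun_def split: colour.split)
  have d1: "(deriv_prod (?n h) (?m h) (?g h) has_field_derivative
      (\<Sum>a<?n h. deriv_prod (?n h) (m1 h a) (?g h) x)) (at x)" for h x
    unfolding m1_def by (rule has_field_derivative_deriv_prod) (rule smooth)
  have d2: "(deriv_prod (?n h) (m1 h a) (?g h) has_field_derivative
      (\<Sum>b<?n h. deriv_prod (?n h) (m2 h a b) (?g h) x)) (at x)" for h a x
    unfolding m2_def by (rule has_field_derivative_deriv_prod) (rule smooth)
  have D1: "deriv ((generator \<alpha> \<beta> ^^ k) f) = (\<lambda>x. \<Sum>h\<in>histories k. ?w h *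
      (\<Sum>a<?n h. deriv_prod (?n h) (m1 h a) (?g h) x))"
    unfolding Suc.IH elem_diff_grown
    by (rule ext, rule DERIV_imp_deriv, rule DERIV_sum, rule DERIV_cmult, rule d1)
  have D2: "deriv (deriv ((generator \<alpha> \<beta> ^^ k) f)) = (\<lambda>x. \<Sum>h\<in>histories k. ?w h *
      (\<Sum>a<?n h. \<Sum>b<?n h. deriv_prod (?n h) (m2 h a b) (?g h) x))"
    unfolding D1
    by (rule ext, rule DERIV_imp_deriv, rule DERIV_sum, rule DERIV_cmult, rule DERIV_sum, rule d2)
  show ?case
  proof
    fix x
    have "(\<Sum>h\<in>histories (Suc k). ?w h * elem_diff \<alpha> \<beta> f x (grown h)) =
      (\<Sum>h\<in>histories k.
        (\<Sum>a<?n h. ?w h * (\<alpha> x * deriv_prod (?n h) (m1 h a) (?g h) x)) +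
        (\<Sum>a<?n h. \<Sum>b<?n h. 1/2 * ?w h * ((\<beta> x)\<^sup>2 * deriv_prod (?n h) (m2 h a b) (?g h) x)))"
      unfolding sum_histories_Suc sum_growths card_pairing_grown
      by (intro sum.cong refl arg_cong2[where f = plus])
        (simp_all add: elem_diff_GrowAlpha elem_diff_GrowBeta m1_def m2_def Let_def del: grown.simps)
    also have "\<dots> = generator \<alpha> \<beta> ((generator \<alpha> \<beta> ^^ k) f) x"
      unfolding generator_def[of \<alpha> \<beta> "(generator \<alpha> \<beta> ^^ k) f"] D2 unfolding D1
      by (simp add: sum.distrib sum_distrib_left mult_ac)
    finally show "(generator \<alpha> \<beta> ^^ Suc k) f x =
        (\<Sum>h\<in>histories (Suc k). ?w h * elem_diff \<alpha> \<beta> f x (grown h))"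
      by simp
  qed
qed

section \<open>Volumes of regions of ordered times\<close>

abbreviation time_measure :: "real \<Rightarrow> real measure" where
  "time_measure T \<equiv> restrict_space lborel {0..T}"

text \<open>The list names the blocks in order of increasing time.  Times decrease from the root towards the
  leaves, so in this order the blocks closest to the root come last.\<close>

definition increasing_region :: "real \<Rightarrow> real \<Rightarrow> 'b list \<Rightarrow> ('b \<Rightarrow> real) set" where
  "increasing_region T t bs = {s \<in> space (Pi\<^sub>M (set bs) (\<lambda>_. time_measure T)).
     sorted_wrt (\<lambda>b b'. s b < s b') bs \<and> (\<forall>b\<in>set bs. s b < t)}"

lemma finite_time_measure: "finite_measure (time_measure T)"
  by (rule finite_measureI) (simp add: space_restrict_space emeasure_restrict_space emeasure_lborel_Icc_eq)

lemma measurable_time: "b \<in> B \<Longrightarrow> (\<lambda>s. s b) \<in> borel_measurable (Pi\<^sub>M B (\<lambda>_. time_measure T))"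
  by (rule measurable_compose[OF measurable_component_singleton]) (auto intro: measurable_restrict_space1)

lemma measurable_sorted_wrt_times:
  assumes "set bs \<subseteq> B"
  shows "Measurable.pred (Pi\<^sub>M B (\<lambda>_. time_measure T)) (\<lambda>s. sorted_wrt (\<lambda>b b'. s b < s b') bs)"
  using assms
proof (induction bs)
  case (Cons b bs)
  then have [measurable]: "b' \<in> set (b # bs) \<Longrightarrow>
      (\<lambda>s. s b') \<in> borel_measurable (Pi\<^sub>M B (\<lambda>_. time_measure T))" for b'
    by (intro measurable_time) auto
  have "Measurable.pred (Pi\<^sub>M B (\<lambda>_. time_measure T)) (\<lambda>s. \<forall>b'\<in>set bs. s b < s b')"
    by (intro pred_intros_finite) auto
  with Cons show ?case by simp
qed simp

lemma sets_increasing_region: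
  "increasing_region T t bs \<in> sets (Pi\<^sub>M (set bs) (\<lambda>_. time_measure T))"
proof -
  have [measurable]: "b \<in> set bs \<Longrightarrow>
      (\<lambda>s. s b) \<in> borel_measurable (Pi\<^sub>M (set bs) (\<lambda>_. time_measure T))" for b
    by (rule measurable_time)
  have [measurable]: "Measurable.pred (Pi\<^sub>M (set bs) (\<lambda>_. time_measure T)) (\<lambda>s. \<forall>b\<in>set bs. s b < t)"
    by (intro pred_intros_finite) auto
  show ?thesis
    unfolding increasing_region_def using measurable_sorted_wrt_times[of bs "set bs" T] by measurable
qed

text \<open>Integrate over the largest time \<open>y\<close> last: below it remains a region with one block less and with
  \<open>t\<close> replaced by \<open>y\<close>, of volume \<open>y\<^sup>n / n!\<close> by induction.\<close>

lemma emeasure_increasing_region: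
  assumes "distinct bs" "0 \<le> t" "t \<le> T"
  shows "emeasure (Pi\<^sub>M (set bs) (\<lambda>_. time_measure T)) (increasing_region T t bs) =
    ennreal (t ^ length bs / fact (length bs))"
  using assms
proof (induction bs arbitrary: t rule: rev_induct)
  case Nil
  then show ?case by (simp add: increasing_region_def PiM_empty)
next
  case (snoc b bs)
  interpret product_sigma_finite "\<lambda>_. time_measure T"
    by (intro product_sigma_finite.intro finite_measure.sigma_finite_measure finite_time_measure)
  let ?P = "\<lambda>B. Pi\<^sub>M B (\<lambda>_. time_measure T)" and ?n = "length bs"
  have b: "b \<notin> set bs" "finite (set bs)" using snoc.prems by auto
  have set_eq: "set (bs @ [b]) = insert b (set bs)" by auto
  have *: "x(b := y) \<in> increasing_region T t (bs @ [b]) \<longleftrightarrow> y < t \<and> x \<in> increasing_region T y bs"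
    if "x \<in> space (?P (set bs))" "y \<in> space (time_measure T)" for x y
  proof -
    have 1: "x(b := y) \<in> space (?P (set (bs @ [b])))"
      using that by (auto simp: space_PiM PiE_def extensional_def)
    have 2: "(x(b := y)) c = x c" if "c \<in> set bs" for c using b that by auto
    have 3: "sorted_wrt (\<lambda>c c'. (x(b := y)) c < (x(b := y)) c') bs = sorted_wrt (\<lambda>c c'. x c < x c') bs"
      using 2 by (intro iffI; elim sorted_wrt_mono_rel[rotated]) simp_all
    show ?thesis
      using 1 that b
      unfolding increasing_region_def mem_Collect_eq sorted_wrt_append 3
      by (auto simp: 2)
  qed
  have "emeasure (?P (set (bs @ [b]))) (increasing_region T t (bs @ [b])) =
      (\<integral>\<^sup>+ s. indicator (increasing_region T t (bs @ [b])) s \<partial>?P (insert b (set bs)))"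
    using sets_increasing_region[of T t "bs @ [b]"] unfolding set_eq by simp
  also have "\<dots> = (\<integral>\<^sup>+ y. (\<integral>\<^sup>+ x. indicator (increasing_region T t (bs @ [b])) (x(b := y))
      \<partial>?P (set bs)) \<partial>time_measure T)"
    using sets_increasing_region[of T t "bs @ [b]"] b unfolding set_eq
    by (intro product_nn_integral_insert_rev) auto
  also have "\<dots> = (\<integral>\<^sup>+ y. ennreal (y ^ ?n / fact ?n) * indicator {0..<t} y \<partial>time_measure T)"
  proof (rule nn_integral_cong)
    fix y assume y: "y \<in> space (time_measure T)"
    then have y': "0 \<le> y" "y \<le> T" by (auto simp: space_restrict_space)
    have "(\<integral>\<^sup>+ x. indicator (increasing_region T t (bs @ [b])) (x(b := y)) \<partial>?P (set bs)) =
        (\<integral>\<^sup>+ x. indicator {0..<t} y * indicator (increasing_region T y bs) x \<partial>?P (set bs))"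
      using * y y' by (intro nn_integral_cong) (simp add: indicator_def)
    also have "\<dots> = indicator {0..<t} y * emeasure (?P (set bs)) (increasing_region T y bs)"
      by (subst nn_integral_cmult_indicator) (simp_all add: sets_increasing_region)
    also have "\<dots> = ennreal (y ^ ?n / fact ?n) * indicator {0..<t} y"
      using snoc.IH[of y] snoc.prems y' by (simp add: mult.commute)
    finally show "(\<integral>\<^sup>+ x. indicator (increasing_region T t (bs @ [b])) (x(b := y)) \<partial>?P (set bs)) =
        ennreal (y ^ ?n / fact ?n) * indicator {0..<t} y" .
  qed
  also have "\<dots> = (\<integral>\<^sup>+ y. ennreal (y ^ ?n / fact ?n) * indicator {0..<t} y * indicator {0..T} y \<partial>lborel)"
    by (subst nn_integral_restrict_space) auto
  \<comment> \<open>The endpoint is added back to obtain a compact interval for the fundamental theorem of calculus.\<close>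
  also have "\<dots> = (\<integral>\<^sup>+ y. ennreal (y ^ ?n / fact ?n) * indicator {0..t} y \<partial>lborel)"
  proof (rule nn_integral_cong_AE)
    show "AE y in lborel. ennreal (y ^ ?n / fact ?n) * indicator {0..<t} y * indicator {0..T} y =
        ennreal (y ^ ?n / fact ?n) * indicator {0..t} y"
      by (rule AE_mp[OF AE_lborel_singleton[of t]], rule AE_I2)
        (use snoc.prems in \<open>auto simp: indicator_def\<close>)
  qed
  also have "\<dots> = ennreal (t ^ Suc ?n / fact (Suc ?n) - 0 ^ Suc ?n / fact (Suc ?n))"
  proof (rule nn_integral_FTC_Icc)
    fix y :: real assume "y \<in> {0..t}"
    show "((\<lambda>y. y ^ Suc ?n / fact (Suc ?n)) has_real_derivative y ^ ?n / fact ?n) (at y)"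
      using DERIV_cdivide[OF DERIV_pow[of "Suc ?n" y UNIV], of "fact (Suc ?n)"]
      by (simp add: fact_Suc del: power_Suc of_nat_Suc)
    show "0 \<le> y ^ ?n / fact ?n" using \<open>y \<in> {0..t}\<close> by simp
  qed (use snoc.prems in auto)
  finally show ?case by simp
qed

text \<open>Both lists, mapped to times, are the sorted enumeration of the same finite set of reals.\<close>

lemma disjoint_increasing_region:
  fixes B :: "'b set"
  assumes "bs \<in> permutations_of_set B" "bs' \<in> permutations_of_set B" "bs \<noteq> bs'"
  shows "increasing_region T t bs \<inter> increasing_region T t bs' = {}"
proof (rule ccontr)
  assume "increasing_region T t bs \<inter> increasing_region T t bs' \<noteq> {}"
  then obtain s :: "'b \<Rightarrow> real" where s: "sorted_wrt (\<lambda>b b'. s b < s b') bs" "sorted_wrt (\<lambda>b b'. s b < s b') bs'"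
    by (auto simp: increasing_region_def)
  have B: "set bs = B" "set bs' = B" "distinct bs" "distinct bs'"
    using assms by (auto simp: permutations_of_set_def)
  have sorted: "sorted_wrt (<) (map s bs)" "sorted_wrt (<) (map s bs')"
    using s by (simp_all add: sorted_wrt_map)
  have "map s bs = map s bs'"
    by (rule strict_sorted_equal) (use sorted B in simp_all)
  moreover have "inj_on s B"
    using sorted(1) B strict_sorted_iff[of "map s bs"] by (simp add: distinct_map)
  ultimately show False
    using assms(3) B map_inj_on[of s bs bs'] by simp
qed

text \<open>That ties have measure zero follows by counting: the \<open>k!\<close> disjoint regions of volume \<open>t\<^sup>k / k!\<close>
  already exhaust the volume \<open>t\<^sup>k\<close> of the cube.\<close>

lemma AE_increasing_region:
  assumes "finite B" "0 \<le> t" "t \<le> T"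
  shows "AE s in Pi\<^sub>M B (\<lambda>_. time_measure T).
    (\<forall>b\<in>B. s b < t) \<longrightarrow> (\<exists>bs\<in>permutations_of_set B. s \<in> increasing_region T t bs)"
proof -
  interpret finite_measure "time_measure T" by (rule finite_time_measure)
  interpret product_sigma_finite "\<lambda>_. time_measure T"
    by (intro product_sigma_finite.intro sigma_finite_measure)
  let ?P = "Pi\<^sub>M B (\<lambda>_. time_measure T)"
  define R where "R = (\<Union>bs\<in>permutations_of_set B. increasing_region T t bs)"
  define C where "C = (\<Pi>\<^sub>E b\<in>B. {0..<t})"
  have C_eq: "C = {s \<in> space ?P. \<forall>b\<in>B. s b < t}"
    using assms by (fastforce simp: C_def space_PiM space_restrict_space PiE_iff)
  have [measurable]: "increasing_region T t bs \<in> sets ?P" if "bs \<in> permutations_of_set B" for bs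
    using sets_increasing_region[of T t bs] that by (simp add: permutations_of_set_def)
  have R: "R \<in> sets ?P"
    unfolding R_def by (intro sets.finite_UN) auto
  have meas: "emeasure ?P (increasing_region T t bs) = ennreal (t ^ card B / fact (card B))"
    if "bs \<in> permutations_of_set B" for bs
    using that emeasure_increasing_region[of bs t T] assms
    by (auto simp: permutations_of_set_def distinct_card)
  have "emeasure ?P C = (\<Prod>b\<in>B. emeasure (time_measure T) {0..<t})"
    unfolding C_def using assms
    by (intro emeasure_PiM) (auto simp: sets_restrict_space image_iff intro!: exI[of _ "{0..<t}"])
  also have "\<dots> = ennreal (t ^ card B)"
    using assms by (simp add: emeasure_restrict_space subset_eq ennreal_power)
  finally have C: "emeasure ?P C = ennreal (t ^ card B)" .
  have "emeasure ?P R = (\<Sum>bs\<in>permutations_of_set B. emeasure ?P (increasing_region T t bs))"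
    unfolding R_def using disjoint_increasing_region[of _ B]
    by (intro sum_emeasure[symmetric]) (auto simp: disjoint_family_on_def)
  also have "\<dots> = ennreal (t ^ card B)"
    using assms
    by (simp add: meas ennreal_of_nat_eq_real_of_nat ennreal_mult[symmetric])
  finally have "emeasure ?P R = emeasure ?P C" using C by simp
  moreover have "R \<subseteq> C"
    unfolding R_def C_eq by (auto simp: increasing_region_def permutations_of_set_def)
  moreover have C_sets: "C \<in> sets ?P"
    unfolding C_def using assms
    by (intro sets_PiM_I_finite) (auto simp: sets_restrict_space image_iff intro!: exI[of _ "{0..<t}"])
  ultimately have "emeasure ?P (C - R) = 0"
    using R C by (subst emeasure_Diff) auto
  then have "C - R \<in> null_sets ?P"
    using R C_sets by auto
  then show ?thesis
    by (rule AE_I') (auto simp: C_eq R_def)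
qed

section \<open>The exotic realization counts linear extensions\<close>

text \<open>The parent of a vertex sits in a block strictly further down the list (or is the root).  Lists in
  this form match growth histories, which also have the newest block at the head.\<close>

primrec parents_later :: "'v ctree \<Rightarrow> 'v set list \<Rightarrow> bool" where
  "parents_later \<tau> [] = True"
| "parents_later \<tau> (b # bs) =
     ((\<forall>(v, w)\<in>edges \<tau>. w \<in> b \<longrightarrow> v = troot \<tau> \<or> v \<in> \<Union> (set bs)) \<and> parents_later \<tau> bs)"

definition linear_extensions :: "'v ctree \<Rightarrow> 'v set list set" where
  "linear_extensions \<tau> = {bs \<in> permutations_of_set (time_blocks \<tau>). parents_later \<tau> bs}"

definition respects_edges :: "'v ctree \<Rightarrow> ('v set \<Rightarrow> real) \<Rightarrow> bool" where
  "respects_edges \<tau> s \<longleftrightarrow>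
     (\<forall>(v, w)\<in>edges \<tau>. v \<noteq> troot \<tau> \<longrightarrow> s (block_of \<tau> w) < s (block_of \<tau> v))"

text \<open>Stated for lists that need not contain all blocks, so that it can be proved by induction.\<close>

lemma parents_later_imp_respects_edges:
  assumes "exotic_tree \<tau>" "parents_later \<tau> bs" "set bs \<subseteq> time_blocks \<tau>"
    "sorted_wrt (\<lambda>b b'. s b < s b') bs"
    "(v, w) \<in> edges \<tau>" "v \<noteq> troot \<tau>" "w \<in> \<Union> (set bs)"
  shows "s (block_of \<tau> w) < (s (block_of \<tau> v) :: real)"
  using assms(2-)
proof (induction bs)
  case (Cons b bs)
  show ?case
  proof (cases "w \<in> b")
    case True
    then obtain b' where "b' \<in> set bs" "v \<in> b'"
      using Cons.prems by auto
    moreover have "block_of \<tau> w = b" "block_of \<tau> v = b'"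
      using block_of_eqI[OF assms(1)] True Cons.prems(2) \<open>b' \<in> set bs\<close> \<open>v \<in> b'\<close> by auto
    ultimately show ?thesis using Cons.prems by auto
  next
    case False
    with Cons show ?thesis by auto
  qed
qed simp

text \<open>The prefix \<open>cs\<close> makes the induction over final segments of the list possible: a parent's block has
  a larger time than \<open>b\<close>, hence can lie neither in \<open>cs\<close> nor at \<open>b\<close> itself.\<close>

lemma respects_edges_imp_parents_later:
  fixes s :: "'v set \<Rightarrow> real"
  assumes "exotic_tree \<tau>" "respects_edges \<tau> s" "set (cs @ bs) = time_blocks \<tau>"
    "sorted_wrt (\<lambda>b b'. s b < s b') (cs @ bs)"
  shows "parents_later \<tau> bs"
  using assms(3,4)
proof (induction bs arbitrary: cs)
  case (Cons b bs)
  have "parents_later \<tau> bs"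
    using Cons.IH[of "cs @ [b]"] Cons.prems by simp
  moreover have "v \<in> \<Union> (set bs)" if e: "(v, w) \<in> edges \<tau>" "w \<in> b" "v \<noteq> troot \<tau>" for v w
  proof -
    have "block_of \<tau> w = b"
      using block_of_eqI[OF assms(1) _ e(2)] Cons.prems by auto
    \<comment> \<open>The edge makes the parent's block strictly later in time than \<open>b\<close>.\<close>
    then have less: "s b < s (block_of \<tau> v)"
      using assms(2) e by (auto simp: respects_edges_def)
    have v: "block_of \<tau> v \<in> set (cs @ b # bs)" "v \<in> block_of \<tau> v"
      using block_of[OF assms(1)] exotic_tree_edges(2)[OF assms(1) e(1,3)] Cons.prems(1) by auto
    then have "block_of \<tau> v \<in> set bs"
      using Cons.prems(2) less by (force simp: sorted_wrt_append)
    with v show ?thesis by auto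
  qed
  ultimately show ?case by auto
qed simp

lemma respects_edges_iff_parents_later:
  assumes "exotic_tree \<tau>" "bs \<in> permutations_of_set (time_blocks \<tau>)" "s \<in> increasing_region T t bs"
  shows "respects_edges \<tau> s \<longleftrightarrow> parents_later \<tau> bs"
proof
  have bs: "set bs = time_blocks \<tau>" "sorted_wrt (\<lambda>b b'. s b < s b') bs"
    using assms by (auto simp: permutations_of_set_def increasing_region_def)
  show "parents_later \<tau> bs" if "respects_edges \<tau> s"
    using respects_edges_imp_parents_later[OF assms(1) that, of "[]" bs] bs by simp
  show "respects_edges \<tau> s" if "parents_later \<tau> bs"
    unfolding respects_edges_def
  proof clarify
    fix v w assume "(v, w) \<in> edges \<tau>" "v \<noteq> troot \<tau>"
    moreover have "w \<in> \<Union> (set bs)"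
      using exotic_tree_edges(1)[OF assms(1) \<open>(v, w) \<in> edges \<tau>\<close>]
        partition_onD1[OF partition_on_time_blocks[OF assms(1)]] bs by simp
    ultimately show "s (block_of \<tau> w) < s (block_of \<tau> v)"
      using parents_later_imp_respects_edges[OF assms(1) that] bs by simp
  qed
qed

text \<open>Times decrease along edges, so the bound \<open>t\<close> on the children of the root propagates to every
  vertex.\<close>

lemma respects_edges_bounded:
  assumes "exotic_tree \<tau>" "respects_edges \<tau> s"
    "\<And>w. (troot \<tau>, w) \<in> edges \<tau> \<Longrightarrow> s (block_of \<tau> w) < t" "b \<in> time_blocks \<tau>"
  shows "s b < t"
proof -
  obtain v where v: "v \<in> b"
    using partition_onD3[OF partition_on_time_blocks[OF assms(1)]] assms(4) by fastforce
  have inner: "v \<in> inner_verts \<tau>"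
    using partition_onD1[OF partition_on_time_blocks[OF assms(1)]] assms(4) v by auto
  then have "(troot \<tau>, v) \<in> (edges \<tau>)\<^sup>*"
    using assms(1) by (auto simp: exotic_tree_def rooted_tree_def inner_verts_def)
  then have "v \<noteq> troot \<tau> \<longrightarrow> s (block_of \<tau> v) < t"
  proof (induction rule: rtrancl_induct)
    case (step v w)
    then show ?case
      using assms(2,3) by (cases "v = troot \<tau>") (auto simp: respects_edges_def)
  qed simp
  then show ?thesis
    using inner block_of_eqI[OF assms(1,4) v] by (simp add: inner_verts_def)
qed

lemma prod_heaviside:
  "finite E \<Longrightarrow> (\<Prod>e\<in>E. heaviside (x e)) = (if \<forall>e\<in>E. x e > 0 then 1 else 0)"
  by (induction E rule: finite_induct) (auto simp: heaviside_def)

text \<open>Almost everywhere the integrand is the sum of the indicator functions of the regions belonging to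
  the linear extensions.\<close>

lemma exotic_realization_eq:
  assumes tree: "exotic_tree \<tau>" and t: "0 \<le> t" "t \<le> T"
  shows "exotic_realization T t \<tau> =
    t ^ card (time_blocks \<tau>) / fact (card (time_blocks \<tau>)) * card (linear_extensions \<tau>)"
proof -
  let ?B = "time_blocks \<tau>" and ?r = "troot \<tau>"
  let ?P = "Pi\<^sub>M ?B (\<lambda>_. time_measure T)"
  define g where "g s = (\<Prod>e\<in>{e \<in> edges \<tau>. fst e = ?r}. heaviside (t - s (block_of \<tau> (snd e)))) *
    (\<Prod>e\<in>{e \<in> edges \<tau>. fst e \<noteq> ?r}.
      heaviside (s (block_of \<tau> (fst e)) - s (block_of \<tau> (snd e))))" for s
  have fin: "finite ?B" "finite (edges \<tau>)" using exotic_tree_finite[OF tree] by auto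
  have g_eq: "g s = (if (\<forall>b\<in>?B. s b < t) \<and> respects_edges \<tau> s then 1 else 0)" for s
  proof -
    have "g s = (if (\<forall>w. (?r, w) \<in> edges \<tau> \<longrightarrow> s (block_of \<tau> w) < t) \<and> respects_edges \<tau> s then 1 else 0)"
      using fin unfolding g_def respects_edges_def by (auto simp: prod_heaviside)
    also have "(\<forall>w. (?r, w) \<in> edges \<tau> \<longrightarrow> s (block_of \<tau> w) < t) \<and> respects_edges \<tau> s \<longleftrightarrow>
        (\<forall>b\<in>?B. s b < t) \<and> respects_edges \<tau> s"
      using respects_edges_bounded[OF tree] block_of(1)[OF tree] exotic_tree_edges(1)[OF tree] by blast
    finally show ?thesis .
  qed
  have region: "increasing_region T t bs \<in> sets ?P" "integral\<^sup>L ?P (indicator (increasing_region T t bs)) =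
      t ^ card ?B / fact (card ?B)" "integrable ?P (indicator (increasing_region T t bs) :: _ \<Rightarrow> real)"
    if "bs \<in> permutations_of_set ?B" for bs
  proof -
    from that have bs: "set bs = ?B" "distinct bs" "length bs = card ?B"
      using distinct_card[of bs] by (auto simp: permutations_of_set_def)
    show S: "increasing_region T t bs \<in> sets ?P"
      using sets_increasing_region[of T t bs] bs by simp
    have E: "emeasure ?P (increasing_region T t bs) = ennreal (t ^ card ?B / fact (card ?B))"
      using emeasure_increasing_region[of bs t T] bs t by simp
    then have "measure ?P (increasing_region T t bs) = t ^ card ?B / fact (card ?B)"
      using t by (simp add: measure_def)
    then show "integral\<^sup>L ?P (indicator (increasing_region T t bs)) = t ^ card ?B / fact (card ?B)"
      using sets.sets_into_space[OF S] by (simp add: Int_absorb2)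
    show "integrable ?P (indicator (increasing_region T t bs) :: _ \<Rightarrow> real)"
      using S E by (intro integrable_real_indicator) auto
  qed
  have meas: "g \<in> borel_measurable ?P"
  proof -
    have [measurable]: "heaviside \<in> borel_measurable borel"
      unfolding heaviside_def by measurable
    have [measurable]: "(\<lambda>s. s (block_of \<tau> v)) \<in> borel_measurable ?P" if "v \<in> inner_verts \<tau>" for v
      using measurable_time[OF block_of(1)[OF tree that]] .
    show ?thesis
      unfolding g_def using exotic_tree_edges[OF tree]
      by (intro borel_measurable_times borel_measurable_prod measurable_compose[OF _ \<open>heaviside \<in> _\<close>]
          borel_measurable_diff) auto
  qed
  have perm: "bs \<in> permutations_of_set ?B" if "bs \<in> linear_extensions \<tau>" for bs
    using that by (simp add: linear_extensions_def)
  have "exotic_realization T t \<tau> = integral\<^sup>L ?P g"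
    unfolding exotic_realization_def g_def[abs_def] ..
  also have "\<dots> = (\<integral>s. (\<Sum>bs\<in>linear_extensions \<tau>. indicator (increasing_region T t bs) s) \<partial>?P)"
  proof (rule integral_cong_AE)
    show "AE s in ?P. g s = (\<Sum>bs\<in>linear_extensions \<tau>. indicator (increasing_region T t bs) s)"
    proof (rule AE_mp[OF AE_increasing_region[OF fin(1) t] AE_I2], rule impI)
      fix s assume s: "(\<forall>b\<in>?B. s b < t) \<longrightarrow>
        (\<exists>bs\<in>permutations_of_set ?B. s \<in> increasing_region T t bs)"
      show "g s = (\<Sum>bs\<in>linear_extensions \<tau>. indicator (increasing_region T t bs) s)"
      proof (cases "\<forall>b\<in>?B. s b < t")
        case True
        then obtain bs where bs: "bs \<in> permutations_of_set ?B" "s \<in> increasing_region T t bs"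
          using s by auto
        have "indicator (increasing_region T t bs') s = (if bs' = bs then 1 else 0 :: real)"
          if "bs' \<in> linear_extensions \<tau>" for bs'
          using disjoint_increasing_region[OF bs(1) perm[OF that]] bs(2) by (auto simp: indicator_def)
        then have "(\<Sum>bs'\<in>linear_extensions \<tau>. indicator (increasing_region T t bs') s) =
            (\<Sum>bs'\<in>linear_extensions \<tau>. if bs' = bs then 1 else 0 :: real)"
          by (rule sum.cong[OF refl])
        then show ?thesis
          using True bs respects_edges_iff_parents_later[OF tree bs]
          by (auto simp: g_eq linear_extensions_def)
      next
        case False
        then have "s \<notin> increasing_region T t bs" if "bs \<in> linear_extensions \<tau>" for bs
          using perm[OF that] by (auto simp: increasing_region_def permutations_of_set_def)
        with False show ?thesis by (auto simp: g_eq)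
      qed
    qed
  qed (use meas region(1) perm in auto)
  also have "\<dots> = (\<Sum>bs\<in>linear_extensions \<tau>. t ^ card ?B / fact (card ?B))"
    using region perm by (subst Bochner_Integration.integral_sum) auto
  finally show ?thesis by simp
qed

section \<open>Isomorphism classes\<close>

lemma tree_iso_cong:
  assumes "tree_iso \<phi> \<tau> \<tau>'" "exotic_tree \<tau>" "\<And>v. v \<in> verts \<tau> \<Longrightarrow> \<psi> v = \<phi> v"
  shows "tree_iso \<psi> \<tau> \<tau>'"
proof -
  have r: "troot \<tau> \<in> verts \<tau>" and e: "edges \<tau> \<subseteq> verts \<tau> \<times> verts \<tau>"
    and p: "\<And>P. P \<in> pairing \<tau> \<Longrightarrow> P \<subseteq> verts \<tau>"
    using assms(2) by (auto simp: exotic_tree_def rooted_tree_def inner_verts_def partition_on_def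
        verts_of_def)
  have "bij_betw \<psi> (verts \<tau>) (verts \<tau>') = bij_betw \<phi> (verts \<tau>) (verts \<tau>')"
    by (rule bij_betw_cong) (rule assms(3))
  moreover have "map_prod \<psi> \<psi> ` edges \<tau> = map_prod \<phi> \<phi> ` edges \<tau>"
    using e assms(3) by (intro image_cong) auto
  moreover have "(`) \<psi> ` pairing \<tau> = (`) \<phi> ` pairing \<tau>"
    using p assms(3) by (intro image_cong) (auto intro!: image_cong)
  ultimately show ?thesis
    using assms(1) r assms(3) by (auto simp: tree_iso_def inner_verts_def)
qed

lemma tree_iso_verts_of:
  assumes "tree_iso \<phi> \<tau> \<tau>'" "exotic_tree \<tau>"
  shows "bij_betw \<phi> (verts_of c \<tau>) (verts_of c \<tau>')"
proof -
  have b: "bij_betw \<phi> (inner_verts \<tau>) (inner_verts \<tau>')"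
    using tree_iso_inner assms exotic_tree_root by blast
  moreover have "\<phi> ` verts_of c \<tau> = verts_of c \<tau>'"
  proof -
    have "verts_of c \<tau>' = {w \<in> \<phi> ` inner_verts \<tau>. colr \<tau>' w = c}"
      using bij_betw_imp_surj_on[OF b] by (simp add: verts_of_def)
    moreover have "colr \<tau>' (\<phi> v) = colr \<tau> v" if "v \<in> inner_verts \<tau>" for v
      using assms(1) that by (simp add: tree_iso_def)
    ultimately show ?thesis by (auto simp: verts_of_def)
  qed
  ultimately show ?thesis
    unfolding bij_betw_def by (auto simp: verts_of_def intro: inj_on_subset)
qed

lemma tree_iso_card_pairing:
  assumes "tree_iso \<phi> \<tau> \<tau>'" "exotic_tree \<tau>"
  shows "card (pairing \<tau>') = card (pairing \<tau>)"
proof -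
  have "inj_on \<phi> (\<Union> (pairing \<tau>))"
    using assms partition_onD1[of "verts_of Beta \<tau>" "pairing \<tau>"]
    by (auto simp: exotic_tree_def tree_iso_def bij_betw_def verts_of_def inner_verts_def
        intro: inj_on_subset)
  then have "inj_on ((`) \<phi>) (pairing \<tau>)"
    by (rule inj_on_image)
  then show ?thesis
    using assms(1) by (simp add: tree_iso_def card_image)
qed

lemma tree_iso_tree_order:
  assumes "tree_iso \<phi> \<tau> \<tau>'" "exotic_tree \<tau>"
  shows "tree_order \<tau>' = tree_order \<tau>"
  using bij_betw_same_card[OF tree_iso_verts_of[OF assms]] by (simp add: tree_order_def)

lemma tree_iso_num_children:
  assumes "tree_iso \<phi> \<tau> \<tau>'" "exotic_tree \<tau>" "v \<in> verts \<tau>"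
  shows "num_children \<tau>' (\<phi> v) = num_children \<tau> v"
proof -
  have inj: "inj_on \<phi> (verts \<tau>)" and e: "edges \<tau>' = map_prod \<phi> \<phi> ` edges \<tau>"
    using assms(1) by (auto simp: tree_iso_def bij_betw_def)
  have sub: "edges \<tau> \<subseteq> verts \<tau> \<times> verts \<tau>"
    using assms(2) by (auto simp: exotic_tree_def rooted_tree_def inner_verts_def)
  have "{e \<in> edges \<tau>'. fst e = \<phi> v} = map_prod \<phi> \<phi> ` {e \<in> edges \<tau>. fst e = v}"
    unfolding e using sub inj_onD[OF inj _ _ assms(3)] by force
  moreover have "inj_on (map_prod \<phi> \<phi>) {e \<in> edges \<tau>. fst e = v}"
    by (rule inj_on_subset[OF map_prod_inj_on[OF inj inj]]) (use sub in auto)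
  ultimately show ?thesis
    by (simp add: num_children_def card_image)
qed

lemma tree_iso_elem_diff:
  assumes "tree_iso \<phi> \<tau> \<tau>'" "exotic_tree \<tau>"
  shows "elem_diff \<alpha> \<beta> f x \<tau>' = elem_diff \<alpha> \<beta> f x \<tau>"
proof -
  let ?c = "\<lambda>\<tau> v. (deriv ^^ num_children \<tau> v) (case colr \<tau> v of Alpha \<Rightarrow> \<alpha> | Beta \<Rightarrow> \<beta>) x"
  have root: "num_children \<tau>' (troot \<tau>') = num_children \<tau> (troot \<tau>)"
    using assms tree_iso_num_children[OF assms exotic_tree_root] by (simp add: tree_iso_def)
  have "(\<Prod>v\<in>inner_verts \<tau>'. ?c \<tau>' v) = (\<Prod>v\<in>inner_verts \<tau>. ?c \<tau>' (\<phi> v))"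
    using tree_iso_inner[OF assms(1) exotic_tree_root[OF assms(2)]]
    by (rule prod.reindex_bij_betw[symmetric])
  also have "\<dots> = (\<Prod>v\<in>inner_verts \<tau>. ?c \<tau> v)"
    using assms tree_iso_num_children[OF assms]
    by (intro prod.cong refl) (simp add: tree_iso_def inner_verts_def)
  finally show ?thesis
    by (simp add: elem_diff_def root)
qed

lemma rep_exotic_trees:
  assumes "C \<in> exotic_trees"
  shows "rep C \<in> C" "exotic_tree (rep C)" "C = iso_rel `` {rep C}"
proof -
  show 1: "rep C \<in> C"
    using in_quotient_imp_non_empty[OF equiv_iso_rel assms[unfolded exotic_trees_def]]
    unfolding rep_def by (auto intro: someI)
  then show "exotic_tree (rep C)"
    using in_quotient_imp_subset[OF equiv_iso_rel assms[unfolded exotic_trees_def]] by auto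
  show "C = iso_rel `` {rep C}"
    using assms 1 unfolding exotic_trees_def
    by (metis Image_singleton_iff equiv_class_eq equiv_iso_rel quotientE)
qed

text \<open>This turns membership in a class into the existence of an isomorphism onto its representative.\<close>

lemma iso_class_eq_iff:
  assumes "C \<in> exotic_trees" "exotic_tree \<tau>"
  shows "iso_rel `` {\<tau>} = C \<longleftrightarrow> (\<exists>\<phi>. tree_iso \<phi> \<tau> (rep C))"
proof -
  have "iso_rel `` {\<tau>} = C \<longleftrightarrow> (\<tau>, rep C) \<in> iso_rel"
    using rep_exotic_trees[OF assms(1)] eq_equiv_class_iff[OF equiv_iso_rel, of \<tau> "rep C"] assms(2)
    by auto
  then show ?thesis
    using rep_exotic_trees(2)[OF assms(1)] assms(2) by (simp add: iso_rel_def)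
qed

lemma finite_ctrees:
  "finite {\<tau> :: nat ctree. verts \<tau> \<subseteq> {..<n} \<and> troot \<tau> < n \<and> edges \<tau> \<subseteq> {..<n} \<times> {..<n} \<and>
     (\<forall>v. v \<notin> {..<n} \<longrightarrow> colr \<tau> v = Alpha) \<and> pairing \<tau> \<subseteq> Pow {..<n}}" (is "finite ?Z")
proof -
  let ?D = "Pow {..<n} \<times> {..<n} \<times> Pow ({..<n} \<times> {..<n}) \<times>
    {c. \<forall>v. (v \<in> {..<n} \<longrightarrow> c v \<in> {Alpha, Beta}) \<and> (v \<notin> {..<n} \<longrightarrow> c v = Alpha)} \<times> Pow (Pow {..<n})"
  have "?Z \<subseteq> (\<lambda>(V, r, E, c, P). \<lparr>verts = V, troot = r, edges = E, colr = c, pairing = P\<rparr>) ` ?D"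
  proof
    fix \<tau> assume \<tau>: "\<tau> \<in> ?Z"
    obtain V r E c P where eq: "\<tau> = \<lparr>verts = V, troot = r, edges = E, colr = c, pairing = P\<rparr>"
      by (cases \<tau>)
    have "c v \<in> {Alpha, Beta}" for v by (cases "c v") auto
    with \<tau> eq have "(V, r, E, c, P) \<in> ?D" by simp
    then show "\<tau> \<in> (\<lambda>(V, r, E, c, P). \<lparr>verts = V, troot = r, edges = E, colr = c, pairing = P\<rparr>) ` ?D"
      using eq by (intro image_eqI[of _ _ "(V, r, E, c, P)"]) simp_all
  qed
  moreover have "finite ?D"
    by (intro finite_cartesian_product finite_set_of_finite_funs) auto
  ultimately show ?thesis
    by (meson finite_imageI finite_subset)
qed

text \<open>Relabelling moves a tree onto small vertices, with its colours reset to a default value elsewhere so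
  that only finitely many trees \<open>\<nu>\<close> can arise.\<close>

lemma ex_tree_iso_bounded:
  assumes "exotic_tree \<tau>" "card (verts \<tau>) \<le> n"
  shows "\<exists>\<nu> \<phi>. tree_iso \<phi> \<tau> \<nu> \<and> verts \<nu> \<subseteq> {..<n} \<and> troot \<nu> < n \<and> edges \<nu> \<subseteq> {..<n} \<times> {..<n} \<and>
     (\<forall>v. v \<notin> {..<n} \<longrightarrow> colr \<nu> v = Alpha) \<and> pairing \<nu> \<subseteq> Pow {..<(n::nat)}"
proof -
  have fin: "finite (verts \<tau>)" and r: "troot \<tau> \<in> verts \<tau>" and e: "edges \<tau> \<subseteq> verts \<tau> \<times> verts \<tau>"
    and p: "pairing \<tau> \<subseteq> Pow (verts \<tau>)"
    using assms(1) by (auto simp: exotic_tree_def rooted_tree_def inner_verts_def partition_on_def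
        verts_of_def)
  obtain \<phi> where "bij_betw \<phi> (verts \<tau>) {0..<card (verts \<tau>)}"
    using ex_bij_betw_finite_nat[OF fin] by blast
  then have inj: "inj_on \<phi> (verts \<tau>)" and im: "\<phi> ` verts \<tau> \<subseteq> {..<n}"
    using assms(2) by (auto simp: bij_betw_def)
  define \<nu> where "\<nu> = \<lparr>verts = \<phi> ` verts \<tau>, troot = \<phi> (troot \<tau>), edges = map_prod \<phi> \<phi> ` edges \<tau>,
    colr = (\<lambda>w. if w \<in> \<phi> ` verts \<tau> then colr \<tau> (inv_into (verts \<tau>) \<phi> w) else Alpha),
    pairing = (`) \<phi> ` pairing \<tau>\<rparr>"
  have "tree_iso \<phi> \<tau> \<nu>"
    using inj by (auto simp: tree_iso_def \<nu>_def bij_betw_def inner_verts_def)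
  moreover have "verts \<nu> \<subseteq> {..<n}" "troot \<nu> < n" "edges \<nu> \<subseteq> {..<n} \<times> {..<n}"
    "\<forall>v. v \<notin> {..<n} \<longrightarrow> colr \<nu> v = Alpha" "pairing \<nu> \<subseteq> Pow {..<n}"
  proof -
    have im': "\<phi> v < n" if "v \<in> verts \<tau>" for v using im that by auto
    show "verts \<nu> \<subseteq> {..<n}" "troot \<nu> < n" using im r by (auto simp: \<nu>_def)
    show "edges \<nu> \<subseteq> {..<n} \<times> {..<n}" using im' e by (auto simp: \<nu>_def)
    show "\<forall>v. v \<notin> {..<n} \<longrightarrow> colr \<nu> v = Alpha" using im by (auto simp: \<nu>_def)
    show "pairing \<nu> \<subseteq> Pow {..<n}" using im' p by (auto simp: \<nu>_def)
  qed
  ultimately show ?thesis by blast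
qed

text \<open>A class is determined by any relabelled copy of its representative, and a tree of order \<open>k + 1\<close> has
  at most \<open>2k + 1\<close> vertices, so there are finitely many copies to choose from.\<close>

lemma finite_exotic_trees_of_order:
  "finite {C \<in> exotic_trees. tree_order (rep C) = k + 1}" (is "finite ?S")
proof -
  let ?n = "2 * k + 1"
  let ?Z = "{\<tau> :: nat ctree. verts \<tau> \<subseteq> {..<?n} \<and> troot \<tau> < ?n \<and> edges \<tau> \<subseteq> {..<?n} \<times> {..<?n} \<and>
     (\<forall>v. v \<notin> {..<?n} \<longrightarrow> colr \<tau> v = Alpha) \<and> pairing \<tau> \<subseteq> Pow {..<?n}}"
  have "\<forall>C\<in>?S. \<exists>\<nu>. \<nu> \<in> ?Z \<and> (\<exists>\<phi>. tree_iso \<phi> (rep C) \<nu>)"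
  proof
    fix C assume C: "C \<in> ?S"
    let ?\<tau> = "rep C"
    have tree: "exotic_tree ?\<tau>" using rep_exotic_trees(2) C by auto
    have "verts ?\<tau> = insert (troot ?\<tau>) (verts_of Alpha ?\<tau> \<union> verts_of Beta ?\<tau>)"
      using exotic_tree_root[OF tree] verts_of_Alpha_Un_Beta[of ?\<tau>] by (auto simp: inner_verts_def)
    then have "card (verts ?\<tau>) \<le> Suc (card (verts_of Alpha ?\<tau> \<union> verts_of Beta ?\<tau>))"
      by (simp add: card_insert_le_m1)
    also have "\<dots> \<le> Suc (card (verts_of Alpha ?\<tau>) + card (verts_of Beta ?\<tau>))"
      by (simp add: card_Un_le)
    also have "\<dots> \<le> ?n"
      using C card_Beta_eq[OF tree] by (simp add: tree_order_def)
    finally show "\<exists>\<nu>. \<nu> \<in> ?Z \<and> (\<exists>\<phi>. tree_iso \<phi> ?\<tau> \<nu>)"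
      using ex_tree_iso_bounded[OF tree] by blast
  qed
  from bchoice[OF this] obtain nf
    where nf: "\<forall>C\<in>?S. nf C \<in> ?Z \<and> (\<exists>\<phi>. tree_iso \<phi> (rep C) (nf C))" ..
  have "inj_on nf ?S"
  proof (rule inj_onI)
    fix C D assume CD: "C \<in> ?S" "D \<in> ?S" "nf C = nf D"
    then obtain \<phi> \<psi> where iso: "tree_iso \<phi> (rep C) (nf C)" "tree_iso \<psi> (rep D) (nf C)"
      using nf[rule_format, OF CD(1)] nf[rule_format, OF CD(2)] by auto
    have trees: "exotic_tree (rep C)" "exotic_tree (rep D)" using CD rep_exotic_trees(2) by auto
    have "tree_iso (inv_into (verts (rep D)) \<psi> \<circ> \<phi>) (rep C) (rep D)"
      using tree_iso_comp[OF iso(1) tree_iso_inverse[OF iso(2) trees(2)] exotic_tree_root[OF trees(1)]] .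
    then have "iso_rel `` {rep C} = D"
      using iso_class_eq_iff[of D "rep C"] CD trees by blast
    then show "C = D"
      using rep_exotic_trees(3) CD by auto
  qed
  moreover have "nf ` ?S \<subseteq> ?Z" using nf by blast
  ultimately show ?thesis
    using finite_ctrees[of ?n] by (meson inj_on_finite)
qed

section \<open>Histories growing a copy of a given tree\<close>

text \<open>The images under \<open>\<phi>\<close> of the blocks of a grown tree, newest first, each listed in order of creation.
  The history and \<open>\<phi>\<close> can both be recovered from this list and the target tree.\<close>

primrec numbering :: "(nat \<Rightarrow> 'v) \<Rightarrow> growth list \<Rightarrow> 'v list list" where
  "numbering \<phi> [] = []"
| "numbering \<phi> (g # h) = (case g of GrowAlpha a \<Rightarrow> [\<phi> (num_verts h)]
     | GrowBeta a b \<Rightarrow> [\<phi> (num_verts h), \<phi> (Suc (num_verts h))]) # numbering \<phi> h"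

definition block_numberings :: "'v ctree \<Rightarrow> 'v list list set" where
  "block_numberings \<tau> = {ls. map set ls \<in> linear_extensions \<tau> \<and> (\<forall>l\<in>set ls. distinct l)}"

text \<open>Isomorphisms are made \<^const>\<open>extensional\<close> so that they can be counted.\<close>

definition isos :: "growth list \<Rightarrow> 'v ctree \<Rightarrow> (nat \<Rightarrow> 'v) set" where
  "isos h \<tau> = {\<phi> \<in> extensional {..<num_verts h}. tree_iso \<phi> (grown h) \<tau>}"

lemma numbering_cong:
  "(\<And>v. v < num_verts h \<Longrightarrow> \<phi> v = \<psi> v) \<Longrightarrow> numbering \<phi> h = numbering \<psi> h"
  by (induction h) (auto split: growth.split)

text \<open>The list fixes the values of \<open>\<phi>\<close> block by block, and each step of the history is forced by the
  unique parent of its new vertices in \<open>\<tau>\<close>.  The maps need not be isomorphisms onto \<open>\<tau>\<close>, because the induction passes to shorter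
  histories, whose trees cover a part of \<open>\<tau>\<close> only.\<close>

lemma numbering_inject:
  assumes "exotic_tree \<tau>"
    and "h \<in> histories k" "h' \<in> histories k" "numbering \<phi> h = numbering \<psi> h'"
    and "inj_on \<phi> {..<num_verts h}" "\<phi> 0 = \<psi> 0"
    and "map_prod \<phi> \<phi> ` edges (grown h) \<subseteq> edges \<tau>" "map_prod \<psi> \<psi> ` edges (grown h') \<subseteq> edges \<tau>"
  shows "h = h' \<and> (\<forall>v<num_verts h. \<phi> v = \<psi> v)"
  using assms(2-)
proof (induction k arbitrary: h h')
  case 0
  then show ?case by simp
next
  case (Suc k)
  obtain g i g' i' where h: "h = g # i" "i \<in> histories k" "g \<in> growths (num_verts i)"
    and h': "h' = g' # i'" "i' \<in> histories k" "g' \<in> growths (num_verts i')"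
    using Suc.prems(1,2) by auto
  have inj: "inj_on \<phi> {..<num_verts i}"
    using Suc.prems(4) unfolding h(1) by (rule inj_on_subset) (auto split: growth.splits)
  have edges: "map_prod \<phi> \<phi> ` edges (grown i) \<subseteq> edges \<tau>" "map_prod \<psi> \<psi> ` edges (grown i') \<subseteq> edges \<tau>"
    using Suc.prems(6,7) unfolding h(1) h'(1) by (auto simp: Let_def split: growth.splits)
  have IH: "i = i'" "\<And>v. v < num_verts i \<Longrightarrow> \<phi> v = \<psi> v"
    using Suc.IH[OF h(2) h'(2) _ inj Suc.prems(5) edges] Suc.prems(3) unfolding h(1) h'(1) by auto
  let ?n = "num_verts i"
  have parent: "a = a'"
    if "a < ?n" "a' < ?n" "(\<phi> a, w) \<in> edges \<tau>" "(\<psi> a', w) \<in> edges \<tau>" for a a' w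
    using unique_parent[OF assms(1) that(3,4)] IH(2)[OF that(2)] inj_onD[OF inj, of a a'] that by auto
  show ?case
  proof (cases g)
    case (GrowAlpha a)
    with Suc.prems(3) obtain a' where g': "g' = GrowAlpha a'" "\<phi> ?n = \<psi> ?n"
      unfolding h(1) h'(1) IH(1) by (cases g') auto
    have "a = a'"
      using Suc.prems(6,7) h(3) h'(3) g' GrowAlpha unfolding h(1) h'(1)
      by (intro parent[of _ _ "\<phi> ?n"]) (auto simp: growths_def Let_def IH(1))
    with g' GrowAlpha IH show ?thesis by (auto simp: h h' less_Suc_eq)
  next
    case (GrowBeta a b)
    with Suc.prems(3) obtain a' b' where g': "g' = GrowBeta a' b'" "\<phi> ?n = \<psi> ?n" "\<phi> (Suc ?n) = \<psi> (Suc ?n)"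
      unfolding h(1) h'(1) IH(1) by (cases g') auto
    have "a = a'"
      using Suc.prems(6,7) h(3) h'(3) g' GrowBeta unfolding h(1) h'(1)
      by (intro parent[of _ _ "\<phi> ?n"]) (auto simp: growths_def Let_def IH(1))
    moreover have "b = b'"
      using Suc.prems(6,7) h(3) h'(3) g' GrowBeta unfolding h(1) h'(1)
      by (intro parent[of _ _ "\<phi> (Suc ?n)"]) (auto simp: growths_def Let_def IH(1))
    ultimately show ?thesis using g' GrowBeta IH by (auto simp: h h' less_Suc_eq)
  qed
qed

text \<open>Parents are created before their children, and \<open>\<phi>\<close> carries this over to \<open>\<tau>\<close>.  It is an embedding
  rather than an isomorphism so that the induction can pass to shorter histories.\<close>

lemma numbering_parents_later:
  assumes "exotic_tree \<tau>" "h \<in> histories k" "inj_on \<phi> {..<num_verts h}" "\<phi> 0 = troot \<tau>"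
    and "map_prod \<phi> \<phi> ` edges (grown h) \<subseteq> edges \<tau>"
    and "\<And>v. v \<in> verts_of Alpha (grown h) \<Longrightarrow> \<phi> v \<in> verts_of Alpha \<tau>"
    and "(`) \<phi> ` pairing (grown h) \<subseteq> pairing \<tau>"
  shows "parents_later \<tau> (map set (numbering \<phi> h)) \<and> distinct (map set (numbering \<phi> h)) \<and>
    set (map set (numbering \<phi> h)) \<subseteq> time_blocks \<tau> \<and> (\<forall>l\<in>set (numbering \<phi> h). distinct l) \<and>
    \<Union> (set (map set (numbering \<phi> h))) = \<phi> ` {0<..<num_verts h}"
  using assms(2-)
proof (induction k arbitrary: h)
  case 0
  then show ?case by auto
next
  case (Suc k)
  obtain g i where h: "h = g # i" "i \<in> histories k" "g \<in> growths (num_verts i)"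
    using Suc.prems(1) by auto
  let ?n = "num_verts i"
  have n: "0 < ?n" by (rule grown_simps(3))
  have inj: "inj_on \<phi> {..<?n}"
    using Suc.prems(2) unfolding h(1) by (rule inj_on_subset) (auto split: growth.splits)
  have edges: "map_prod \<phi> \<phi> ` edges (grown i) \<subseteq> edges \<tau>"
    using Suc.prems(4) unfolding h(1) by (auto simp: Let_def split: growth.splits)
  have alpha: "\<phi> v \<in> verts_of Alpha \<tau>" if "v \<in> verts_of Alpha (grown i)" for v
    using Suc.prems(5)[of v] that unfolding h(1) by (cases g) (auto simp: verts_of_grown simp del: grown.simps)
  have pairs: "(`) \<phi> ` pairing (grown i) \<subseteq> pairing \<tau>"
    using Suc.prems(6) unfolding h(1) by (auto simp: Let_def split: growth.splits)
  note IH = Suc.IH[OF h(2) inj Suc.prems(3) edges alpha pairs]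
  have parent: "u = troot \<tau> \<or> u \<in> \<phi> ` {0<..<?n}" if "(\<phi> a, w) \<in> edges \<tau>" "a < ?n" "(u, w) \<in> edges \<tau>" for a u w
    using unique_parent[OF assms(1) that(3,1)] that(2) Suc.prems(3) by (cases "a = 0") auto
  have new: "\<phi> m \<notin> \<phi> ` {0<..<?n}" if "?n \<le> m" "m < num_verts h" for m
  proof
    assume "\<phi> m \<in> \<phi> ` {0<..<?n}"
    then obtain v where "v < ?n" "\<phi> m = \<phi> v" by auto
    with inj_onD[OF Suc.prems(2), of m v] that show False by auto
  qed
  have fresh: "set l \<notin> set (map set (numbering \<phi> i))" if "\<phi> m \<in> set l" "?n \<le> m" "m < num_verts h" for l m
  proof
    assume "set l \<in> set (map set (numbering \<phi> i))"
    then have "set l \<subseteq> \<phi> ` {0<..<?n}" using IH by blast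
    then show False using new[OF that(2,3)] that(1) by blast
  qed
  show ?case
  proof (cases g)
    case (GrowAlpha a)
    have e: "(\<phi> a, \<phi> ?n) \<in> edges \<tau>" "a < ?n"
      using Suc.prems(4) h(3) unfolding h(1) GrowAlpha by (auto simp: Let_def growths_def)
    have "{\<phi> ?n} \<in> time_blocks \<tau>"
      using Suc.prems(5)[of ?n] unfolding h(1) GrowAlpha
      by (simp add: verts_of_grown time_blocks_def del: grown.simps)
    moreover have "set [\<phi> ?n] \<notin> set (map set (numbering \<phi> i))"
      using fresh[of ?n "[\<phi> ?n]"] by (simp add: h(1) GrowAlpha)
    moreover have "{0<..<Suc ?n} = insert ?n {0<..<?n}" using n by auto
    ultimately show ?thesis
      using IH parent[OF e] by (auto simp: h(1) GrowAlpha)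
  next
    case (GrowBeta a b)
    have e: "(\<phi> a, \<phi> ?n) \<in> edges \<tau>" "a < ?n" "(\<phi> b, \<phi> (Suc ?n)) \<in> edges \<tau>" "b < ?n"
      using Suc.prems(4) h(3) unfolding h(1) GrowBeta by (auto simp: Let_def growths_def)
    have "{\<phi> ?n, \<phi> (Suc ?n)} \<in> time_blocks \<tau>"
      using Suc.prems(6) unfolding h(1) GrowBeta by (simp add: time_blocks_def Let_def)
    moreover have "set [\<phi> ?n, \<phi> (Suc ?n)] \<notin> set (map set (numbering \<phi> i))"
      using fresh[of ?n "[\<phi> ?n, \<phi> (Suc ?n)]"] by (simp add: h(1) GrowBeta)
    moreover have "\<phi> ?n \<noteq> \<phi> (Suc ?n)"
      using inj_onD[OF Suc.prems(2), of ?n "Suc ?n"] by (auto simp: h(1) GrowBeta)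
    moreover have "{0<..<Suc (Suc ?n)} = insert ?n (insert (Suc ?n) {0<..<?n})" using n by auto
    ultimately show ?thesis
      using IH parent[OF e(1,2)] parent[OF e(3,4)] by (auto simp: h(1) GrowBeta)
  qed
qed

lemma numbering_in_block_numberings:
  assumes "exotic_tree \<tau>" "h \<in> histories k" "tree_iso \<phi> (grown h) \<tau>"
  shows "numbering \<phi> h \<in> block_numberings \<tau>"
proof -
  have tree: "exotic_tree (grown h)" by (rule exotic_tree_grown[OF assms(2)])
  have alpha: "\<phi> v \<in> verts_of Alpha \<tau>" if "v \<in> verts_of Alpha (grown h)" for v
    using tree_iso_verts_of[OF assms(3) tree] that by (auto simp: bij_betw_def)
  have "inj_on \<phi> {..<num_verts h}" "\<phi> 0 = troot \<tau>"
    "map_prod \<phi> \<phi> ` edges (grown h) \<subseteq> edges \<tau>" "(`) \<phi> ` pairing (grown h) \<subseteq> pairing \<tau>"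
    using assms(3) by (auto simp: tree_iso_def bij_betw_def grown_simps)
  note N = numbering_parents_later[OF assms(1,2) this(1,2,3) alpha this(4)]
  have "inner_verts (grown h) = {0<..<num_verts h}"
    by (auto simp: inner_verts_def grown_simps)
  then have "\<phi> ` {0<..<num_verts h} = inner_verts \<tau>"
    using tree_iso_inner[OF assms(3) exotic_tree_root[OF tree]] by (simp add: bij_betw_def)
  with N have "set (map set (numbering \<phi> h)) = time_blocks \<tau>"
    by (intro time_blocks_eq_if_Union[OF assms(1)]) auto
  with N show ?thesis
    by (simp add: block_numberings_def linear_extensions_def permutations_of_set_def)
qed

text \<open>The subtree on a set \<open>V\<close> of vertices; it is meant for sets that contain the root and are closed
  under taking parents, so that an edge belongs to it as soon as its lower end does.\<close>

definition lower_part :: "'v ctree \<Rightarrow> 'v set \<Rightarrow> 'v ctree" where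
  "lower_part \<tau> V = \<tau>\<lparr>verts := V, edges := {e \<in> edges \<tau>. snd e \<in> V},
     pairing := {P \<in> pairing \<tau>. P \<subseteq> V}\<rparr>"

lemma lower_part_verts:
  assumes "exotic_tree \<tau>"
  shows "lower_part \<tau> (verts \<tau>) = \<tau>"
proof -
  have "{e \<in> edges \<tau>. snd e \<in> verts \<tau>} = edges \<tau>" "{P \<in> pairing \<tau>. P \<subseteq> verts \<tau>} = pairing \<tau>"
    using assms by (auto simp: exotic_tree_def rooted_tree_def inner_verts_def partition_on_def verts_of_def)
  then show ?thesis by (simp add: lower_part_def)
qed

text \<open>Extending an isomorphism by one new \<open>\<alpha>\<close>-leaf, which has to be hung on the vertex that corresponds to
  the parent of \<open>v\<close> in \<open>\<tau>\<close>.\<close>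

lemma tree_iso_GrowAlpha:
  assumes tree: "exotic_tree \<tau>" and h: "h \<in> histories k" and iso: "tree_iso \<phi> (grown h) (lower_part \<tau> V)"
    and v: "v \<notin> V" "v \<in> verts_of Alpha \<tau>" and e: "(\<phi> a, v) \<in> edges \<tau>" and a: "a < num_verts h"
  shows "tree_iso (\<phi>(num_verts h := v)) (grown (GrowAlpha a # h)) (lower_part \<tau> (insert v V))"
proof -
  let ?n = "num_verts h" and ?\<psi> = "\<phi>(num_verts h := v)"
  have iso': "tree_iso ?\<psi> (grown h) (lower_part \<tau> V)"
    by (rule tree_iso_cong[OF iso exotic_tree_grown[OF h]]) (simp add: grown_simps)
  have i: "bij_betw ?\<psi> {..<?n} V" "?\<psi> 0 = troot \<tau>"
    "{e \<in> edges \<tau>. snd e \<in> V} = map_prod ?\<psi> ?\<psi> ` edges (grown h)"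
    "\<And>m. m \<in> inner_verts (grown h) \<Longrightarrow> colr \<tau> (?\<psi> m) = colr (grown h) m"
    "{P \<in> pairing \<tau>. P \<subseteq> V} = (`) ?\<psi> ` pairing (grown h)"
    using iso' by (simp_all add: tree_iso_def lower_part_def grown_simps)
  have bij: "bij_betw ?\<psi> ({?n} \<union> {..<?n}) ({v} \<union> V)"
    using i(1) v(1) by (intro bij_betw_combine) (auto simp: bij_betw_def)
  have edges: "{e \<in> edges \<tau>. snd e \<in> insert v V} = insert (\<phi> a, v) {e \<in> edges \<tau>. snd e \<in> V}"
  proof -
    have "(u, v) \<in> edges \<tau> \<longleftrightarrow> u = \<phi> a" for u using e unique_parent[OF tree _ e] by metis
    then have "x \<in> edges \<tau> \<and> snd x = v \<longleftrightarrow> x = (\<phi> a, v)" for x by (cases x) auto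
    then show ?thesis by blast
  qed
  have "v \<notin> P" if "P \<in> pairing \<tau>" for P
    using pairing_subset_Beta[OF tree that] v(2) by (auto simp: verts_of_def)
  then have pairs: "{P \<in> pairing \<tau>. P \<subseteq> insert v V} = {P \<in> pairing \<tau>. P \<subseteq> V}"
    by auto
  show ?thesis
    unfolding tree_iso_def
  proof (intro conjI ballI)
    show "bij_betw ?\<psi> (verts (grown (GrowAlpha a # h))) (verts (lower_part \<tau> (insert v V)))"
      using bij by (simp add: lower_part_def Let_def grown_simps(1))
    show "?\<psi> (troot (grown (GrowAlpha a # h))) = troot (lower_part \<tau> (insert v V))"
      using i(2) by (simp add: lower_part_def Let_def)
    show "edges (lower_part \<tau> (insert v V)) = map_prod ?\<psi> ?\<psi> ` edges (grown (GrowAlpha a # h))"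
      using edges i(3) a by (simp add: lower_part_def Let_def)
    show "pairing (lower_part \<tau> (insert v V)) = (`) ?\<psi> ` pairing (grown (GrowAlpha a # h))"
      using pairs i(5) by (simp add: lower_part_def Let_def)
    fix m assume "m \<in> inner_verts (grown (GrowAlpha a # h))"
    then have "m = ?n \<or> m \<in> inner_verts (grown h) \<and> m < ?n"
      by (auto simp: inner_verts_def Let_def grown_simps(1) grown_simps(2)[of h])
    then show "colr (lower_part \<tau> (insert v V)) (?\<psi> m) = colr (grown (GrowAlpha a # h)) m"
      using i(4)[of m] v(2) by (auto simp: lower_part_def Let_def verts_of_def)
  qed
qed

text \<open>The analogous extension by a pair.  Neither parent may be the other member of the pair, as both
  have to correspond to vertices that are already there.\<close>

lemma tree_iso_GrowBeta:
  assumes tree: "exotic_tree \<tau>" and h: "h \<in> histories k" and iso: "tree_iso \<phi> (grown h) (lower_part \<tau> V)"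
    and vw: "v \<notin> V" "w \<notin> V" "v \<noteq> w" "{v, w} \<in> pairing \<tau>"
    and e: "(\<phi> a, v) \<in> edges \<tau>" "(\<phi> b, w) \<in> edges \<tau>" and ab: "a < num_verts h" "b < num_verts h"
  shows "tree_iso (\<phi>(num_verts h := v, Suc (num_verts h) := w)) (grown (GrowBeta a b # h))
    (lower_part \<tau> ({v, w} \<union> V))"
proof -
  let ?n = "num_verts h" and ?\<psi> = "\<phi>(num_verts h := v, Suc (num_verts h) := w)"
  have iso': "tree_iso ?\<psi> (grown h) (lower_part \<tau> V)"
    by (rule tree_iso_cong[OF iso exotic_tree_grown[OF h]]) (simp add: grown_simps)
  have i: "bij_betw ?\<psi> {..<?n} V" "?\<psi> 0 = troot \<tau>"
    "{e \<in> edges \<tau>. snd e \<in> V} = map_prod ?\<psi> ?\<psi> ` edges (grown h)"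
    "\<And>m. m \<in> inner_verts (grown h) \<Longrightarrow> colr \<tau> (?\<psi> m) = colr (grown h) m"
    "{P \<in> pairing \<tau>. P \<subseteq> V} = (`) ?\<psi> ` pairing (grown h)"
    using iso' by (simp_all add: tree_iso_def lower_part_def grown_simps)
  have bij: "bij_betw ?\<psi> ({?n, Suc ?n} \<union> {..<?n}) ({v, w} \<union> V)"
    using i(1) vw by (intro bij_betw_combine) (auto simp: bij_betw_def)
  have edges: "{e \<in> edges \<tau>. snd e \<in> {v, w} \<union> V} =
      insert (\<phi> a, v) (insert (\<phi> b, w) {e \<in> edges \<tau>. snd e \<in> V})"
  proof -
    have "(u, v) \<in> edges \<tau> \<longleftrightarrow> u = \<phi> a" for u using e(1) unique_parent[OF tree _ e(1)] by metis
    moreover have "(u, w) \<in> edges \<tau> \<longleftrightarrow> u = \<phi> b" for u using e(2) unique_parent[OF tree _ e(2)] by metis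
    ultimately show ?thesis by auto
  qed
  have "P = {v, w}" if "P \<in> pairing \<tau>" "v \<in> P \<or> w \<in> P" for P
    using pairing_unique[OF tree that(1) vw(4)] that(2) by blast
  then have pairs: "{P \<in> pairing \<tau>. P \<subseteq> {v, w} \<union> V} = insert {v, w} {P \<in> pairing \<tau>. P \<subseteq> V}"
    using vw(4) by blast
  have colour: "v \<in> verts_of Beta \<tau>" "w \<in> verts_of Beta \<tau>"
    using pairing_subset_Beta[OF tree vw(4)] by auto
  show ?thesis
    unfolding tree_iso_def
  proof (intro conjI ballI)
    show "bij_betw ?\<psi> (verts (grown (GrowBeta a b # h))) (verts (lower_part \<tau> ({v, w} \<union> V)))"
      using bij by (simp add: lower_part_def Let_def grown_simps(1))
    show "?\<psi> (troot (grown (GrowBeta a b # h))) = troot (lower_part \<tau> ({v, w} \<union> V))"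
      using i(2) by (simp add: lower_part_def Let_def)
    show "edges (lower_part \<tau> ({v, w} \<union> V)) = map_prod ?\<psi> ?\<psi> ` edges (grown (GrowBeta a b # h))"
      using edges i(3) ab by (simp add: lower_part_def Let_def)
    show "pairing (lower_part \<tau> ({v, w} \<union> V)) = (`) ?\<psi> ` pairing (grown (GrowBeta a b # h))"
      using pairs i(5) by (simp add: lower_part_def Let_def)
    fix m assume "m \<in> inner_verts (grown (GrowBeta a b # h))"
    then have "m = ?n \<or> m = Suc ?n \<or> m \<in> inner_verts (grown h) \<and> m < ?n"
      by (auto simp: inner_verts_def Let_def grown_simps(1) grown_simps(2)[of h])
    then show "colr (lower_part \<tau> ({v, w} \<union> V)) (?\<psi> m) = colr (grown (GrowBeta a b # h)) m"
      using i(4)[of m] colour by (auto simp: lower_part_def Let_def verts_of_def)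
  qed
qed

text \<open>Surjectivity.  Reading the list from its oldest block on, the parents of the vertices of each block
  are already covered, so the isomorphism can be extended by one growth step at a time.\<close>

lemma ex_growth_of_numbering:
  assumes "exotic_tree \<tau>"
    and "parents_later \<tau> (map set ls)" "distinct (map set ls)" "set (map set ls) \<subseteq> time_blocks \<tau>"
    and "\<forall>l\<in>set ls. distinct l"
  shows "\<exists>h\<in>histories (length ls). \<exists>\<phi>. numbering \<phi> h = ls \<and>
    tree_iso \<phi> (grown h) (lower_part \<tau> (insert (troot \<tau>) (\<Union> (set (map set ls)))))"
  using assms(2-)
proof (induction ls)
  case Nil
  have "P \<notin> pairing \<tau>" if "P \<subseteq> {troot \<tau>}" for P
  proof
    assume P: "P \<in> pairing \<tau>"
    then have "P = {}"
      using pairing_subset_Beta[OF assms(1) P] that by (auto simp: verts_of_def inner_verts_def)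
    with P assms(1) show False by (auto simp: exotic_tree_def)
  qed
  moreover have "(v, troot \<tau>) \<notin> edges \<tau>" for v
    using exotic_tree_edges(1)[OF assms(1)] by (auto simp: inner_verts_def)
  ultimately have "tree_iso (\<lambda>_. troot \<tau>) (grown []) (lower_part \<tau> {troot \<tau>})"
    by (auto simp: tree_iso_def lower_part_def bij_betw_def inner_verts_def)
  then show ?case by auto
next
  case (Cons l ls)
  let ?V = "insert (troot \<tau>) (\<Union> (set (map set ls)))"
  obtain h \<phi> where h: "h \<in> histories (length ls)" "numbering \<phi> h = ls"
    and iso: "tree_iso \<phi> (grown h) (lower_part \<tau> ?V)"
    using Cons by auto
  let ?n = "num_verts h"
  have l: "set l \<in> time_blocks \<tau>" "distinct l" using Cons.prems by auto
  have fresh: "v \<notin> ?V" "\<exists>a<?n. (\<phi> a, v) \<in> edges \<tau>" if v: "v \<in> set l" for v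
  proof -
    have inner: "v \<in> inner_verts \<tau>"
      using v l(1) partition_onD1[OF partition_on_time_blocks[OF assms(1)]] by auto
    have "v \<notin> set l'" if "l' \<in> set ls" for l'
    proof
      assume "v \<in> set l'"
      then have "set l' = set l"
        using block_of_eqI[OF assms(1) l(1) v] block_of_eqI[OF assms(1), of "set l'" v]
          Cons.prems(3) that by auto
      with Cons.prems(2) that show False by auto
    qed
    then show "v \<notin> ?V" using inner by (auto simp: inner_verts_def)
    obtain u where u: "(u, v) \<in> edges \<tau>"
      using assms(1) inner by (auto simp: exotic_tree_def rooted_tree_def)
    then have "u \<in> ?V" using Cons.prems(1) v by auto
    moreover have "\<phi> ` {..<?n} = ?V"
      using iso by (simp add: tree_iso_def bij_betw_def grown_simps lower_part_def)
    ultimately obtain a where "a < ?n" "u = \<phi> a" by blast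
    with u show "\<exists>a<?n. (\<phi> a, v) \<in> edges \<tau>" by auto
  qed
  from l(1) consider (alpha) v where "v \<in> verts_of Alpha \<tau>" "set l = {v}" | (beta) "set l \<in> pairing \<tau>"
    by (auto simp: time_blocks_def)
  then show ?case
  proof cases
    case alpha
    then have l_eq: "l = [v]" using l(2) by (cases l; cases "tl l") auto
    obtain a where a: "a < ?n" "(\<phi> a, v) \<in> edges \<tau>" using fresh(2)[of v] l_eq by auto
    define \<psi> where "\<psi> = \<phi>(?n := v)"
    have "numbering \<psi> h = ls" "\<psi> ?n = v"
      using h(2) numbering_cong[of h \<psi> \<phi>] by (simp_all add: \<psi>_def)
    moreover have "GrowAlpha a # h \<in> histories (length (l # ls))"
      using h(1) a by (auto simp: growths_def image_iff)
    moreover have "tree_iso \<psi> (grown (GrowAlpha a # h)) (lower_part \<tau> (insert v ?V))"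
      unfolding \<psi>_def using fresh(1)[of v] l_eq a by (intro tree_iso_GrowAlpha[OF assms(1) h(1) iso _ alpha(1)]) auto
    ultimately show ?thesis
      by (intro bexI[of _ "GrowAlpha a # h"] exI[of _ \<psi>])
        (simp_all add: l_eq insert_commute del: grown.simps histories.simps)
  next
    case beta
    then have "card (set l) = 2" using assms(1) by (simp add: exotic_tree_def)
    then have "length l = 2" using distinct_card[OF l(2)] by simp
    then obtain v w where l_eq: "l = [v, w]" by (auto simp: length_Suc_conv numeral_2_eq_2)
    obtain a b where ab: "a < ?n" "(\<phi> a, v) \<in> edges \<tau>" "b < ?n" "(\<phi> b, w) \<in> edges \<tau>"
      using fresh(2)[of v] fresh(2)[of w] l_eq by auto
    define \<psi> where "\<psi> = \<phi>(?n := v, Suc ?n := w)"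
    have "numbering \<psi> h = ls" "\<psi> ?n = v" "\<psi> (Suc ?n) = w"
      using h(2) numbering_cong[of h \<psi> \<phi>] by (simp_all add: \<psi>_def)
    moreover have "GrowBeta a b # h \<in> histories (length (l # ls))"
      using h(1) ab by (auto simp: growths_def image_iff)
    moreover have "tree_iso \<psi> (grown (GrowBeta a b # h)) (lower_part \<tau> ({v, w} \<union> ?V))"
      unfolding \<psi>_def using fresh(1)[of v] fresh(1)[of w] l_eq l(2) ab beta
      by (intro tree_iso_GrowBeta[OF assms(1) h(1) iso]) auto
    moreover have "{v, w} \<union> ?V = insert (troot \<tau>) (\<Union> (set (map set (l # ls))))"
      by (auto simp: l_eq)
    ultimately show ?thesis
      by (intro bexI[of _ "GrowBeta a b # h"] exI[of _ \<psi>])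
        (simp_all add: l_eq del: grown.simps histories.simps)
  qed
qed

text \<open>A linear extension of \<open>\<tau>\<close> with an order on each pair says in which order the vertices of \<open>\<tau>\<close>
  can be created; the parents in \<open>\<tau>\<close> then dictate the steps of the history.\<close>

lemma bij_betw_numbering:
  assumes "exotic_tree \<tau>"
  shows "bij_betw (\<lambda>(h, \<phi>). numbering \<phi> h)
    (SIGMA h:histories (card (time_blocks \<tau>)). isos h \<tau>) (block_numberings \<tau>)"
proof -
  let ?k = "card (time_blocks \<tau>)"
  have "inj_on (\<lambda>(h, \<phi>). numbering \<phi> h) (SIGMA h:histories ?k. isos h \<tau>)"
  proof (intro inj_onI, clarify)
    fix h \<phi> h' \<psi>
    assume *: "h \<in> histories ?k" "h' \<in> histories ?k" "\<phi> \<in> isos h \<tau>" "\<psi> \<in> isos h' \<tau>"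
      and eq: "numbering \<phi> h = numbering \<psi> h'"
    then have "h = h' \<and> (\<forall>v<num_verts h. \<phi> v = \<psi> v)"
      by (intro numbering_inject[OF assms *(1,2) eq])
        (auto simp: isos_def tree_iso_def bij_betw_def grown_simps)
    with * show "h = h' \<and> \<phi> = \<psi>"
      by (auto simp: isos_def intro: extensionalityI)
  qed
  moreover have "numbering \<phi> h \<in> block_numberings \<tau>" if "h \<in> histories ?k" "\<phi> \<in> isos h \<tau>" for h \<phi>
    using numbering_in_block_numberings[OF assms that(1)] that(2) by (simp add: isos_def)
  moreover have "\<exists>h\<in>histories ?k. \<exists>\<phi>\<in>isos h \<tau>. numbering \<phi> h = ls" if "ls \<in> block_numberings \<tau>" for ls
  proof -
    from that have ls: "parents_later \<tau> (map set ls)" "distinct (map set ls)"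
      "set (map set ls) = time_blocks \<tau>" "\<forall>l\<in>set ls. distinct l"
      by (auto simp: block_numberings_def linear_extensions_def permutations_of_set_def)
    then have len: "length ls = ?k" using distinct_card[OF ls(2)] by simp
    have "insert (troot \<tau>) (\<Union> (set (map set ls))) = verts \<tau>"
      using ls(3) partition_onD1[OF partition_on_time_blocks[OF assms]] exotic_tree_root[OF assms]
      by (auto simp: inner_verts_def)
    then obtain h \<phi> where h: "h \<in> histories ?k" "numbering \<phi> h = ls" "tree_iso \<phi> (grown h) \<tau>"
      using ex_growth_of_numbering[OF assms ls(1,2) _ ls(4)] ls(3) lower_part_verts[OF assms] len by auto
    let ?\<psi> = "restrict \<phi> {..<num_verts h}"
    have "?\<psi> \<in> isos h \<tau>"
      using tree_iso_cong[OF h(3) exotic_tree_grown[OF h(1)], of ?\<psi>] by (simp add: isos_def grown_simps)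
    moreover have "numbering ?\<psi> h = ls"
      using numbering_cong[of h ?\<psi> \<phi>] h(2) by simp
    ultimately show ?thesis using h(1) by blast
  qed
  ultimately show ?thesis
    unfolding bij_betw_def by (fastforce simp: image_iff)
qed

lemma card_orderings_of_blocks:
  fixes bs :: "'b set list"
  assumes "\<forall>b\<in>set bs. finite b"
  shows "card {ls. map set ls = bs \<and> (\<forall>l\<in>set ls. distinct l)} = (\<Prod>b\<leftarrow>bs. fact (card b))"
    and "finite {ls. map set ls = bs \<and> (\<forall>l\<in>set ls. distinct l)}"
proof -
  let ?L = "\<lambda>bs :: 'b set list. {ls. map set ls = bs \<and> (\<forall>l\<in>set ls. distinct l)}"
  have "finite (?L bs) \<and> card (?L bs) = (\<Prod>b\<leftarrow>bs. fact (card b))"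
    using assms
  proof (induction bs)
    case Nil
    have "?L [] = {[]}" by auto
    then show ?case by simp
  next
    case (Cons b bs)
    have eq: "?L (b # bs) = (\<lambda>(l, ls). l # ls) ` (permutations_of_set b \<times> ?L bs)"
      by (auto simp: permutations_of_set_def image_iff map_eq_Cons_conv)
    have "inj_on (\<lambda>(l, ls). l # ls) (permutations_of_set b \<times> ?L bs)"
      by (auto simp: inj_on_def)
    with Cons show ?case
      unfolding eq by (simp add: card_image card_cartesian_product)
  qed
  then show "card (?L bs) = (\<Prod>b\<leftarrow>bs. fact (card b))" "finite (?L bs)" by auto
qed

text \<open>Each pair can be ordered in two ways independently of the others, each singleton in one way.\<close>

lemma card_block_numberings:
  assumes "exotic_tree \<tau>"
  shows "card (block_numberings \<tau>) = 2 ^ card (pairing \<tau>) * card (linear_extensions \<tau>)"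
proof -
  let ?L = "\<lambda>bs. {ls. map set ls = bs \<and> (\<forall>l\<in>set ls. distinct l)}"
  have fin: "finite b" if "b \<in> time_blocks \<tau>" for b
    using that exotic_tree_finite(1)[OF assms] partition_onD1[OF partition_on_time_blocks[OF assms]]
    by (auto intro: finite_subset)
  have card: "card (?L bs) = 2 ^ card (pairing \<tau>)" "finite (?L bs)" if "bs \<in> linear_extensions \<tau>" for bs
  proof -
    from that have bs: "set bs = time_blocks \<tau>" "distinct bs"
      by (auto simp: linear_extensions_def permutations_of_set_def)
    have disj: "(\<lambda>v. {v}) ` verts_of Alpha \<tau> \<inter> pairing \<tau> = {}"
      using assms by (force simp: exotic_tree_def)
    have fins: "finite ((\<lambda>v. {v}) ` verts_of Alpha \<tau>)" "finite (pairing \<tau>)"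
      using exotic_tree_finite(3)[OF assms] by (simp_all add: time_blocks_def)
    have "(\<Prod>b\<leftarrow>bs. fact (card b)) = (\<Prod>b\<in>time_blocks \<tau>. fact (card b) :: nat)"
      using prod.distinct_set_conv_list[OF bs(2)] bs(1) by metis
    also have "\<dots> = (\<Prod>b\<in>(\<lambda>v. {v}) ` verts_of Alpha \<tau>. fact (card b)) * (\<Prod>b\<in>pairing \<tau>. fact (card b))"
      unfolding time_blocks_def using disj fins by (intro prod.union_disjoint)
    also have "(\<Prod>b\<in>(\<lambda>v. {v}) ` verts_of Alpha \<tau>. fact (card b)) = (1 :: nat)"
      by (intro prod.neutral) auto
    also have "(\<Prod>b\<in>pairing \<tau>. fact (card b)) = (\<Prod>b\<in>pairing \<tau>. 2 :: nat)"
      using assms by (intro prod.cong) (auto simp: exotic_tree_def)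
    finally show "card (?L bs) = 2 ^ card (pairing \<tau>)"
      using card_orderings_of_blocks(1)[of bs] fin bs(1) by simp
    show "finite (?L bs)" using card_orderings_of_blocks(2)[of bs] fin bs(1) by simp
  qed
  have "block_numberings \<tau> = (\<Union>bs\<in>linear_extensions \<tau>. ?L bs)"
    by (auto simp: block_numberings_def)
  then have "card (block_numberings \<tau>) = (\<Sum>bs\<in>linear_extensions \<tau>. card (?L bs))"
    using card(2) by (simp, subst card_UN_disjoint) (auto simp: linear_extensions_def)
  also have "\<dots> = 2 ^ card (pairing \<tau>) * card (linear_extensions \<tau>)"
    by (simp add: card(1))
  finally show ?thesis .
qed

text \<open>The isomorphisms onto \<open>\<tau>\<close> form a torsor under the automorphism group of \<open>\<tau>\<close>: composing these
  with one fixed isomorphism \<open>\<phi>\<close> reaches all of them.\<close>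

lemma card_isos:
  assumes "exotic_tree \<tau>" "h \<in> histories k" "tree_iso \<phi> (grown h) \<tau>"
  shows "card (isos h \<tau>) = symmetry_factor \<tau>"
proof -
  let ?A = "{\<psi>. \<psi> permutes verts \<tau> \<and> tree_iso \<psi> \<tau> \<tau>}" and ?N = "{..<num_verts h}"
  let ?inv = "inv_into ?N \<phi>"
  have tree: "exotic_tree (grown h)" and root: "troot (grown h) \<in> verts (grown h)"
    using exotic_tree_grown[OF assms(2)] exotic_tree_root by auto
  have \<phi>: "bij_betw \<phi> ?N (verts \<tau>)" using assms(3) by (simp add: tree_iso_def grown_simps)
  \<comment> \<open>Automorphisms are the identity off the vertex set, isomorphisms are undefined there; the two maps
    below translate between these conventions.\<close>
  have "bij_betw (\<lambda>\<psi>. restrict (\<psi> \<circ> \<phi>) ?N) ?A (isos h \<tau>)"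
  proof (rule bij_betwI[where g = "\<lambda>\<xi> v. if v \<in> verts \<tau> then \<xi> (?inv v) else v"])
    show "(\<lambda>\<psi>. restrict (\<psi> \<circ> \<phi>) ?N) \<in> ?A \<rightarrow> isos h \<tau>"
    proof
      fix \<psi> assume "\<psi> \<in> ?A"
      then have "tree_iso (\<psi> \<circ> \<phi>) (grown h) \<tau>"
        using tree_iso_comp[OF assms(3) _ root] by blast
      then have "tree_iso (restrict (\<psi> \<circ> \<phi>) ?N) (grown h) \<tau>"
        by (rule tree_iso_cong[OF _ tree]) (simp add: grown_simps)
      then show "restrict (\<psi> \<circ> \<phi>) ?N \<in> isos h \<tau>"
        by (simp add: isos_def)
    qed
    show "(\<lambda>\<xi> v. if v \<in> verts \<tau> then \<xi> (?inv v) else v) \<in> isos h \<tau> \<rightarrow> ?A"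
    proof (intro funcsetI CollectI conjI)
      fix \<xi> assume "\<xi> \<in> isos h \<tau>"
      then have \<xi>: "tree_iso \<xi> (grown h) \<tau>" by (simp add: isos_def)
      let ?\<psi> = "\<lambda>v. if v \<in> verts \<tau> then \<xi> (?inv v) else v"
      have "tree_iso (\<xi> \<circ> ?inv) \<tau> \<tau>"
        using tree_iso_comp[OF tree_iso_inverse[OF assms(3) tree] \<xi> exotic_tree_root[OF assms(1)]]
        by (simp add: grown_simps)
      then show "tree_iso ?\<psi> \<tau> \<tau>"
        by (rule tree_iso_cong[OF _ assms(1)]) simp
      then have "bij_betw ?\<psi> (verts \<tau>) (verts \<tau>)" by (simp add: tree_iso_def)
      then show "?\<psi> permutes verts \<tau>"
        by (rule bij_imp_permutes) simp
    qed
    show "(\<lambda>v. if v \<in> verts \<tau> then restrict (\<psi> \<circ> \<phi>) ?N (?inv v) else v) = \<psi>" if "\<psi> \<in> ?A" for \<psi>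
    proof
      fix v
      have "\<psi> v = v" if "v \<notin> verts \<tau>" using \<open>\<psi> \<in> ?A\<close> that by (auto simp: permutes_def)
      moreover have "?inv v \<in> ?N" "\<phi> (?inv v) = v" if "v \<in> verts \<tau>"
        using that \<phi> inv_into_into[of v \<phi> ?N] f_inv_into_f[of v \<phi> ?N] by (simp_all add: bij_betw_def)
      ultimately show "(if v \<in> verts \<tau> then restrict (\<psi> \<circ> \<phi>) ?N (?inv v) else v) = \<psi> v"
        by auto
    qed
    show "restrict ((\<lambda>v. if v \<in> verts \<tau> then \<xi> (?inv v) else v) \<circ> \<phi>) ?N = \<xi>" if "\<xi> \<in> isos h \<tau>" for \<xi>
    proof (rule extensionalityI[of _ ?N])
      fix v assume "v \<in> ?N"
      then show "restrict ((\<lambda>v. if v \<in> verts \<tau> then \<xi> (?inv v) else v) \<circ> \<phi>) ?N v = \<xi> v"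
        using \<phi> bij_betwE[OF \<phi>] by (auto simp: bij_betw_def)
    qed (use that in \<open>auto simp: isos_def\<close>)
  qed
  then show ?thesis
    by (simp add: symmetry_factor_def bij_betw_same_card)
qed

lemma symmetry_factor_pos:
  assumes "exotic_tree \<tau>"
  shows "symmetry_factor \<tau> > 0"
proof -
  have "finite {\<phi>. \<phi> permutes verts \<tau> \<and> tree_iso \<phi> \<tau> \<tau>}"
    using assms finite_permutations[of "verts \<tau>"] by (simp add: exotic_tree_def rooted_tree_def)
  moreover have "(\<lambda>v. v) \<in> {\<phi>. \<phi> permutes verts \<tau> \<and> tree_iso \<phi> \<tau> \<tau>}"
    using tree_iso_refl by (simp add: permutes_def)
  ultimately show ?thesis
    unfolding symmetry_factor_def by (auto simp: card_gt_0_iff)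
qed

lemma finite_isos:
  assumes "exotic_tree \<tau>"
  shows "finite (isos h \<tau>)"
proof (rule finite_subset)
  show "isos h \<tau> \<subseteq> (\<Pi>\<^sub>E v\<in>{..<num_verts h}. verts \<tau>)"
    by (auto simp: isos_def tree_iso_def bij_betw_def grown_simps PiE_def)
  show "finite (\<Pi>\<^sub>E v\<in>{..<num_verts h}. verts \<tau>)"
    using assms by (intro finite_PiE) (auto simp: exotic_tree_def rooted_tree_def)
qed

text \<open>Both sides count the pairs of a history and an isomorphism from the tree it grows onto \<open>\<tau>\<close>.  If
  \<open>\<tau>\<close> cannot be grown, both sides vanish.\<close>

lemma card_histories_of_class:
  assumes "exotic_tree \<tau>"
  shows "card {h \<in> histories (card (time_blocks \<tau>)). \<exists>\<phi>. tree_iso \<phi> (grown h) \<tau>} * symmetry_factor \<tau> =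
    2 ^ card (pairing \<tau>) * card (linear_extensions \<tau>)"
proof -
  let ?H = "histories (card (time_blocks \<tau>))"
  have isos: "card (isos h \<tau>) = (if \<exists>\<phi>. tree_iso \<phi> (grown h) \<tau> then symmetry_factor \<tau> else 0)"
    if "h \<in> ?H" for h
  proof (cases "\<exists>\<phi>. tree_iso \<phi> (grown h) \<tau>")
    case True
    then show ?thesis using card_isos[OF assms that] by auto
  next
    case False
    then have "isos h \<tau> = {}" by (auto simp: isos_def)
    with False show ?thesis by simp
  qed
  have "2 ^ card (pairing \<tau>) * card (linear_extensions \<tau>) = card (SIGMA h:?H. isos h \<tau>)"
    using card_block_numberings[OF assms] bij_betw_same_card[OF bij_betw_numbering[OF assms]] by simp
  also have "\<dots> = (\<Sum>h\<in>?H. card (isos h \<tau>))"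
    by (intro card_SigmaI finite_histories ballI finite_isos[OF assms])
  also have "\<dots> = (\<Sum>h\<in>?H. if \<exists>\<phi>. tree_iso \<phi> (grown h) \<tau> then symmetry_factor \<tau> else 0)"
    by (intro sum.cong refl isos)
  also have "\<dots> = card {h \<in> ?H. \<exists>\<phi>. tree_iso \<phi> (grown h) \<tau>} * symmetry_factor \<tau>"
    by (subst sum.inter_filter[symmetric]) (simp_all add: finite_histories)
  finally show ?thesis by simp
qed

section \<open>The formal series of the expectation\<close>

theorem corollary2p25:
  fixes M :: "'a measure" and F :: "real \<Rightarrow> 'a measure" and W u :: "real \<Rightarrow> 'a \<Rightarrow> real"
    and \<alpha> \<beta> f :: "real \<Rightarrow> real" and T u0 :: real
  assumes "T > 0"
    and "smooth_fun \<alpha>" and "smooth_fun \<beta>" and "smooth_fun f"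
    and "real_analytic \<alpha>" and "real_analytic \<beta>" and "real_analytic f"
    and "wiener_process M F W"
    and "unique_ito_solution M F W T \<alpha> \<beta> u0 u"
  shows "\<forall>k. finite {C \<in> exotic_trees. tree_order (rep C) = k + 1} \<and>
    (\<forall>t\<in>{0..T}. formal_expectation \<alpha> \<beta> f u0 t k =
       (\<Sum>C\<in>{C \<in> exotic_trees. tree_order (rep C) = k + 1}.
          elem_diff \<alpha> \<beta> f u0 (rep C) / real (symmetry_factor (rep C)) *
          exotic_realization T t (rep C)))"
proof (intro allI conjI ballI)
  fix k
  let ?S = "{C \<in> exotic_trees. tree_order (rep C) = k + 1}"
  show fin: "finite ?S" by (rule finite_exotic_trees_of_order)
  fix t assume t: "t \<in> {0..T}"
  define cls where "cls h = iso_rel `` {grown h}" for h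
  have cls: "cls h \<in> ?S" if h: "h \<in> histories k" for h
  proof -
    have tree: "exotic_tree (grown h)" by (rule exotic_tree_grown[OF h])
    then have C: "cls h \<in> exotic_trees"
      unfolding cls_def exotic_trees_def by (intro quotientI) simp
    then obtain \<phi> where "tree_iso \<phi> (grown h) (rep (cls h))"
      using iso_class_eq_iff[OF C tree] by (auto simp: cls_def)
    then show ?thesis
      using C tree_iso_tree_order[OF _ tree] tree_order_grown[OF h] by simp
  qed
  \<comment> \<open>Weight and elementary differential are constant on a class, so only the number of its histories
    matters.\<close>
  have class_sum: "(\<Sum>h\<in>{h \<in> histories k. cls h = C}.
      (1/2) ^ card (pairing (grown h)) * elem_diff \<alpha> \<beta> f u0 (grown h)) =
      elem_diff \<alpha> \<beta> f u0 (rep C) / symmetry_factor (rep C) * card (linear_extensions (rep C))"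
    if C: "C \<in> ?S" for C
  proof -
    let ?\<tau> = "rep C"
    have tree: "exotic_tree ?\<tau>" and CE: "C \<in> exotic_trees" using C rep_exotic_trees(2) by auto
    have k: "card (time_blocks ?\<tau>) = k" using C tree_order_eq[OF tree] by simp
    have iff: "cls h = C \<longleftrightarrow> (\<exists>\<phi>. tree_iso \<phi> (grown h) ?\<tau>)" if "h \<in> histories k" for h
      unfolding cls_def by (rule iso_class_eq_iff[OF CE exotic_tree_grown[OF that]])
    have H: "{h \<in> histories k. cls h = C} = {h \<in> histories k. \<exists>\<phi>. tree_iso \<phi> (grown h) ?\<tau>}"
      using iff by auto
    have "(\<Sum>h\<in>{h \<in> histories k. cls h = C}.
        (1/2) ^ card (pairing (grown h)) * elem_diff \<alpha> \<beta> f u0 (grown h)) =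
        (\<Sum>h\<in>{h \<in> histories k. cls h = C}. (1/2) ^ card (pairing ?\<tau>) * elem_diff \<alpha> \<beta> f u0 ?\<tau>)"
    proof (rule sum.cong[OF refl])
      fix h assume "h \<in> {h \<in> histories k. cls h = C}"
      then obtain \<phi> where "tree_iso \<phi> (grown h) ?\<tau>" "exotic_tree (grown h)"
        unfolding H using exotic_tree_grown by blast
      then show "(1/2) ^ card (pairing (grown h)) * elem_diff \<alpha> \<beta> f u0 (grown h) =
          (1/2) ^ card (pairing ?\<tau>) * elem_diff \<alpha> \<beta> f u0 ?\<tau>"
        using tree_iso_card_pairing tree_iso_elem_diff by metis
    qed
    also have "\<dots> = real (card {h \<in> histories k. cls h = C}) * ((1/2) ^ card (pairing ?\<tau>) * elem_diff \<alpha> \<beta> f u0 ?\<tau>)"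
      by simp
    also have "real (card {h \<in> histories k. cls h = C}) =
        2 ^ card (pairing ?\<tau>) * card (linear_extensions ?\<tau>) / symmetry_factor ?\<tau>"
    proof -
      have "real (card {h \<in> histories k. cls h = C} * symmetry_factor ?\<tau>) =
          real (2 ^ card (pairing ?\<tau>) * card (linear_extensions ?\<tau>))"
        unfolding H using card_histories_of_class[OF tree] k by simp
      then show ?thesis
        using symmetry_factor_pos[OF tree] by (simp add: field_simps)
    qed
    finally show ?thesis by (simp add: power_one_over)
  qed
  have "(generator \<alpha> \<beta> ^^ k) f u0 =
      (\<Sum>h\<in>histories k. (1/2) ^ card (pairing (grown h)) * elem_diff \<alpha> \<beta> f u0 (grown h))"
    by (simp add: generator_power_eq_sum_histories[OF assms(2-4)])
  also have "\<dots> = (\<Sum>C\<in>?S. \<Sum>h\<in>{h \<in> histories k. cls h = C}.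
      (1/2) ^ card (pairing (grown h)) * elem_diff \<alpha> \<beta> f u0 (grown h))"
    using cls by (intro sum.group[symmetric] finite_histories fin) auto
  also have "\<dots> = (\<Sum>C\<in>?S.
      elem_diff \<alpha> \<beta> f u0 (rep C) / symmetry_factor (rep C) * card (linear_extensions (rep C)))"
    by (rule sum.cong[OF refl class_sum])
  finally have "formal_expectation \<alpha> \<beta> f u0 t k = (\<Sum>C\<in>?S. t ^ k / fact k *
      (elem_diff \<alpha> \<beta> f u0 (rep C) / symmetry_factor (rep C) * card (linear_extensions (rep C))))"
    by (simp add: formal_expectation_def sum_distrib_left)
  also have "\<dots> = (\<Sum>C\<in>?S. elem_diff \<alpha> \<beta> f u0 (rep C) / real (symmetry_factor (rep C)) *
      exotic_realization T t (rep C))"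
  proof (rule sum.cong[OF refl])
    fix C assume C: "C \<in> ?S"
    then have tree: "exotic_tree (rep C)" using rep_exotic_trees(2) by auto
    then have "card (time_blocks (rep C)) = k" using C tree_order_eq[OF tree] by simp
    then show "t ^ k / fact k *
        (elem_diff \<alpha> \<beta> f u0 (rep C) / symmetry_factor (rep C) * card (linear_extensions (rep C))) =
        elem_diff \<alpha> \<beta> f u0 (rep C) / real (symmetry_factor (rep C)) * exotic_realization T t (rep C)"
      using exotic_realization_eq[OF tree, of t T] t by (simp add: mult_ac)
  qed
  finally show "formal_expectation \<alpha> \<beta> f u0 t k =
      (\<Sum>C\<in>?S. elem_diff \<alpha> \<beta> f u0 (rep C) / real (symmetry_factor (rep C)) *
         exotic_realization T t (rep C))" .
qed

end
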